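(* Let $1\le k\le n$, $\sigma\in S^k_n$, $C\in\mathbb{S}^{k-1,\sigma}_{>0}$, and consider on the leaf $\mathcal{M}^C_{k,\sigma}$ the parametric leaf-normal form $$\Theta_k+v^{(1)}_{\sigma,C}=\sum_{i=1}^k\omega_{\sigma(i)}\Theta^{\sigma(i)}_{\mathbf 0}+\sum_{j\ge0}a_j(\mu,C)\rho_{\sigma(k)}^{2j}\hat E_{\mathbf 0}+\sum_{i=1}^k\sum_{j\ge0}b^i_j(\mu,C)\rho_{\sigma(k)}^{2j}\Theta^{\sigma(i)}_{\mathbf 0},$$ where $a_j(\cdot,C),b^i_j(\cdot,C)$ are formal power series in the parameters $\mu=(\mu_1,\dots,\mu_r)$ with $a_0(\mathbf 0,C)=b^i_0(\mathbf 0,C)=0$, and $a_j(\mathbf 0,C)\ne0$ for some $j$. Then there are a natural number $s$ (namely $s=\min\{j: a_j(\mathbf 0,C)\neq0\}$), near-identity changes of state variables and time-rescaling such that they transform $\Theta_k+v^{(1)}_{\sigma,C}$ into the infinite-level parametric leaf-normal form $\Theta_k+w^{(\infty)}_{\sigma,C}$, where $w^{(\infty)}_{\sigma,C}$ is given by $$\sum_{i=1}^{k}\sum_{j=0}^{s}(x_{\sigma(k)}^2+y_{\sigma(k)}^2)^j\Big((\hat a_j(\mu,C)x_{\sigma(i)}-\hat b^i_j(\mu,C)y_{\sigma(i)})\frac{\partial}{\partial x_{\sigma(i)}}+(\hat a_j(\mu,C)y_{\sigma(i)}+\hat b^i_j(\mu,C)x_{\sigma(i)})\frac{\partial}{\partial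 y_{\sigma(i)}}\Big),$$ with $\hat a_j(\mathbf 0,C)=\hat b^i_0(\mathbf 0,C)=\hat b^1_j(\mu,C)=0$ for $0\le j\le s-1$, $1\le i\le k$, and $0\ne a_s:=a_s(\mathbf 0,C)=\hat a_s(\mu,C)$.
   Context: $S^k_n$ is the set of permutations $\sigma$ of $\{1,\dots,n\}$ with $\sigma(i)<\sigma(j)$ for $i<j\le k$ and for $k<i<j\le n$. $\mathbb{S}^{k-1,\sigma}_{>0}=\{(c_1,\dots,c_n):\sum_{i\le k}c_{\sigma(i)}^2=1,\ c_{\sigma(i)}>0\ (i\le k),\ c_{\sigma(i)}=0\ (i>k)\}$. With $(\rho_i,\theta_i)$ polar coordinates of $(x_i,y_i)$, the leaf $\mathcal{M}^C_{k,\sigma}\subset\mathbb{R}^{2n}$ is the set where $\rho_{\sigma(i)}=\frac{c_{\sigma(i)}}{c_{\sigma(k)}}\rho_{\sigma(k)}>0$ for $i\le k$ and $(x_{\sigma(i)},y_{\sigma(i)})=0$ for $i>k$. $\Theta^i_{\mathbf 0}=-y_i\partial_{x_i}+x_i\partial_{y_i}=\partial_{\theta_i}$, $\Theta_k=\sum_{i\le k}\omega_{\sigma(i)}\Theta^{\sigma(i)}_{\mathbf 0}$, with all $\omega_i\ne0$ and $\omega_i/\omega_j\notin\mathbb{Q}$ for $i<j$; $\hat E_{\mathbf 0}=\sum_{j=1}^k\frac{c_{\sigma(j)}}{c_{\sigma(k)}}\rho_{\sigma(k)}\partial_{\rho_{\sigma(j)}}$ (the radial field on the leaf). All objects are formal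 power series and the transformations may depend on $\mu$. Let $\mathscr{L}$ be the Lie algebra of (parametric) leaf vector fields spanned by $\mu^{\mathbf m}\rho_{\sigma(k)}^{2j}\hat E_{\mathbf 0}$ and $\mu^{\mathbf m}\rho_{\sigma(k)}^{2j}\Theta^{\sigma(i)}_{\mathbf 0}$, with bracket $[Y,v]=(DY)v-(Dv)Y$. Near-identity state changes are time-one maps of generators $S\in\mathscr{L}$ and act by $v\mapsto\exp(\mathrm{ad}_S)v$; time rescaling $\tau=(1+T)t$, with $T$ a formal power series in $\mu$ and $Z_j=(x_{\sigma(k)}^2+y_{\sigma(k)}^2)^j$ without constant term, acts by $v\mapsto v+Tv$. Use the grading $\delta(\mu^{\mathbf m}\rho_{\sigma(k)}^{2j}\hat E_{\mathbf 0})=|\mathbf m|(s+1)+j$, $\delta(\mu^{\mathbf m}\rho_{\sigma(k)}^{2j}\Theta^{\sigma(i)}_{\mathbf 0})=|\mathbf m|(s+1)+s+j$, $\delta(\mu^{\mathbf m}Z_j)=|\mathbf m|(s+1)+j$, and write $\Theta_k+v^{(1)}_{\sigma,C}=\sum_i v_i$ with $v_i$ of grade $i$. Put $d^{i,1}(T_i,S_i)=T_iv_0+[S_i,v_0]$ and inductively, for $(T_{i-r+1},\dots,T_{i-1},S_{i-r+1},\dots,S_{i-1})\in\ker d^{i-1,r-1}$, $d^{i,r}(T_{i-r+1},\dots,T_i,S_{i-r+1},\dots,S_i)=\sum_{j=1}^{r-1}(T_{i-j}v_j+[S_{i-j},v_j])+T_iv_0+[S_i,v_0]$. A vector field is in $r$-th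 level normal form when its grade-$i$ part lies in a fixed complement $\mathcal{C}^r_i$ of $\mathrm{im}\,d^{i,r}$; it is in infinite-level normal form when its grade-$i$ part lies in a complement $\mathcal{C}^i_i$ of $\mathrm{im}\,d^{i,i}$ for every $i$. *)

theory Defs
  imports
    "HOL-Analysis.Analysis"
    "HOL-Combinatorics.Permutations"
    "HOL-Computational_Algebra.Formal_Power_Series"
    "HOL-Library.Function_Algebras"
begin

section \<open>Formal power series in the parameters\<close>

text \<open>
  A formal real power series in the parameters \<open>\<mu>\<close>, indexed by the finite type \<open>'r\<close>:
  \<open>mcoeff f m\<close> is the coefficient of the monomial with exponent vector \<open>m\<close>.
\<close>

typedef 'r mser = "UNIV :: (('r \<Rightarrow> nat) \<Rightarrow> real) set"
  morphisms mcoeff Abs_mser ..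

lemma mcoeff_Abs [simp]: "mcoeff (Abs_mser f) = f"
  by (simp add: Abs_mser_inverse)

lemma mser_eqI: "(\<And>m. mcoeff f m = mcoeff g m) \<Longrightarrow> f = g"
  by (metis ext mcoeff_inject)

definition splits :: "('r \<Rightarrow> nat) \<Rightarrow> (('r \<Rightarrow> nat) \<times> ('r \<Rightarrow> nat)) set" where
  "splits m = {(a, b). a + b = m}"

lemma finite_splits [simp]: "finite (splits (m :: 'r::finite \<Rightarrow> nat))"
proof -
  have fin: "finite {a. a \<le> m}"
  proof -
    have "{a. a \<le> m} \<subseteq> PiE UNIV (\<lambda>i. {..m i})" by (auto simp: le_fun_def)
    moreover have "finite (PiE (UNIV :: 'r set) (\<lambda>i. {..m i}))" by (intro finite_PiE) auto
    ultimately show ?thesis by (rule finite_subset)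
  qed
  have "splits m \<subseteq> {a. a \<le> m} \<times> {a. a \<le> m}"
    by (auto simp: splits_def le_fun_def)
  thus ?thesis using fin by (meson finite_SigmaI finite_subset)
qed

instantiation mser :: (finite) comm_ring_1
begin

definition "0 = Abs_mser (\<lambda>m. 0)"
definition "1 = Abs_mser (\<lambda>m. if m = 0 then 1 else 0)"
definition "f + g = Abs_mser (\<lambda>m. mcoeff f m + mcoeff g m)"
definition "f - g = Abs_mser (\<lambda>m. mcoeff f m - mcoeff g m)"
definition "- f = Abs_mser (\<lambda>m. - mcoeff f m)"
definition "f * g = Abs_mser (\<lambda>m. \<Sum>(a, b)\<in>splits m. mcoeff f a * mcoeff g b)"

instance
proof
  fix f g h :: "'a mser"
  show "f + g + h = f + (g + h)" "f + g = g + f" "0 + f = f" "- f + f = 0" "f - g = f + - g"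
    by (auto intro!: mser_eqI simp: plus_mser_def zero_mser_def uminus_mser_def minus_mser_def)
  show "(0 :: 'a mser) \<noteq> 1"
  proof
    assume "(0 :: 'a mser) = 1"
    hence "mcoeff (0 :: 'a mser) 0 = mcoeff 1 0" by simp
    thus False by (simp add: zero_mser_def one_mser_def)
  qed
  show "(f + g) * h = f * h + g * h"
    by (auto intro!: mser_eqI
        simp: plus_mser_def times_mser_def distrib_right sum.distrib case_prod_unfold)
  show comm: "f * g = g * f"
  proof (rule mser_eqI)
    fix m
    have "(\<Sum>(a, b)\<in>splits m. mcoeff f a * mcoeff g b)
        = (\<Sum>(a, b)\<in>splits m. mcoeff g a * mcoeff f b)"
      by (rule sum.reindex_bij_witness[of _ prod.swap prod.swap])
         (auto simp: splits_def add.commute mult.commute)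
    thus "mcoeff (f * g) m = mcoeff (g * f) m" by (simp add: times_mser_def)
  qed
  show "1 * f = f"
  proof (rule mser_eqI)
    fix m
    have "(\<Sum>(a, b)\<in>splits m. mcoeff 1 a * mcoeff f b)
        = (\<Sum>(a, b)\<in>{(0, m)}. mcoeff 1 a * mcoeff f b)"
      by (rule sum.mono_neutral_right, simp)
         (auto simp: splits_def one_mser_def split: if_splits)
    thus "mcoeff (1 * f) m = mcoeff f m" by (simp add: times_mser_def one_mser_def)
  qed
  show "f * g * h = f * (g * h)"
  proof (rule mser_eqI)
    fix m
    have "mcoeff (f * g * h) m
        = (\<Sum>(p, z)\<in>splits m. \<Sum>(x, y)\<in>splits p. mcoeff f x * mcoeff g y * mcoeff h z)"
      by (simp add: times_mser_def sum_distrib_right case_prod_unfold)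
    also have "\<dots> = (\<Sum>(P, Q)\<in>Sigma (splits m) (\<lambda>P. splits (fst P)).
        mcoeff f (fst Q) * mcoeff g (snd Q) * mcoeff h (snd P))"
      by (simp add: sum.Sigma case_prod_unfold)
    also have "\<dots> = (\<Sum>(P, Q)\<in>Sigma (splits m) (\<lambda>P. splits (snd P)).
        mcoeff f (fst P) * (mcoeff g (fst Q) * mcoeff h (snd Q)))"
      by (rule sum.reindex_bij_witness
            [of _ "\<lambda>(P, Q). ((fst P + fst Q, snd Q), (fst P, fst Q))"
                  "\<lambda>(P, Q). ((fst Q, snd Q + snd P), (snd Q, snd P))"])
         (auto simp: splits_def add.assoc mult.assoc)
    also have "\<dots> = (\<Sum>(x, p)\<in>splits m. \<Sum>(y, z)\<in>splits p.
        mcoeff f x * (mcoeff g y * mcoeff h z))"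
      by (simp add: sum.Sigma case_prod_unfold)
    also have "\<dots> = mcoeff (f * (g * h)) m"
      by (simp add: times_mser_def sum_distrib_left case_prod_unfold)
    finally show "mcoeff (f * g * h) m = mcoeff (f * (g * h)) m" .
  qed
qed

end

definition mconst :: "real \<Rightarrow> 'r mser" where
  "mconst r = Abs_mser (\<lambda>m. if m = 0 then r else 0)"

definition at_zero :: "'r mser \<Rightarrow> real" where
  "at_zero f = mcoeff f 0"

definition mdeg :: "('r::finite \<Rightarrow> nat) \<Rightarrow> nat" where
  "mdeg m = (\<Sum>i\<in>UNIV. m i)"


section \<open>The leaf\<close>

definition shuffles_nk :: "nat \<Rightarrow> nat \<Rightarrow> (nat \<Rightarrow> nat) set" where
  "shuffles_nk n k = {\<sigma>. \<sigma> permutes {1..n} \<and>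
     (\<forall>i j. 1 \<le> i \<and> i < j \<and> j \<le> k \<longrightarrow> \<sigma> i < \<sigma> j) \<and>
     (\<forall>i j. k < i \<and> i < j \<and> j \<le> n \<longrightarrow> \<sigma> i < \<sigma> j)}"

text \<open>Vectors indexed by \<open>1, \<dots>, n\<close> are functions on \<open>nat\<close> vanishing outside \<open>{1..n}\<close>.\<close>

definition pos_sphere :: "nat \<Rightarrow> nat \<Rightarrow> (nat \<Rightarrow> nat) \<Rightarrow> (nat \<Rightarrow> real) set" where
  "pos_sphere n k \<sigma> = {c. (\<forall>i. i \<notin> {1..n} \<longrightarrow> c i = 0) \<and>
     (\<Sum>i=1..k. (c (\<sigma> i))\<^sup>2) = 1 \<and>
     (\<forall>i\<in>{1..k}. c (\<sigma> i) > 0) \<and> (\<forall>i\<in>{k+1..n}. c (\<sigma> i) = 0)}"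

text \<open>A point of \<open>\<real>\<close>\<open>2n\<close> is a family of pairs \<open>(x i, y i)\<close>.\<close>

type_synonym point = "nat \<Rightarrow> real \<times> real"

definition rho :: "point \<Rightarrow> nat \<Rightarrow> real" where
  "rho p i = sqrt ((fst (p i))\<^sup>2 + (snd (p i))\<^sup>2)"

definition leaf :: "nat \<Rightarrow> nat \<Rightarrow> (nat \<Rightarrow> nat) \<Rightarrow> (nat \<Rightarrow> real) \<Rightarrow> point set" where
  "leaf n k \<sigma> c = {p. (\<forall>i. i \<notin> {1..n} \<longrightarrow> p i = (0, 0)) \<and>
     (\<forall>i\<in>{1..k}. rho p (\<sigma> i) = c (\<sigma> i) / c (\<sigma> k) * rho p (\<sigma> k) \<and> rho p (\<sigma> i) > 0) \<and>
     (\<forall>i\<in>{k+1..n}. p (\<sigma> i) = (0, 0))}"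


section \<open>Formal vector fields on the leaf\<close>

text \<open>
  A (parametric, formal, rotation-invariant) vector field along the leaf is given by its components
  in the frame \<open>\<partial>/\<partial>\<rho>\<close>, \<open>\<partial>/\<partial>\<theta>\<close> of the polar coordinates \<open>(\<rho> i, \<theta> i)\<close> of \<open>(x i, y i)\<close>.
  On the leaf every \<open>\<rho> i\<close> is a multiple of \<open>\<rho> (\<sigma> k)\<close>, so each component is a formal power series
  in the single variable \<open>\<rho> (\<sigma> k)\<close> (the variable \<open>fps_X\<close>), with coefficients that are formal
  power series in the parameters.
\<close>

datatype coord = Rho nat | Theta nat

type_synonym 'r lfun = "'r mser fps"
type_synonym 'r vfield = "coord \<Rightarrow> 'r lfun"

definition smul :: "'r::finite lfun \<Rightarrow> 'r vfield \<Rightarrow> 'r vfield" where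
  "smul f v = (\<lambda>q. f * v q)"

definition rconst :: "real \<Rightarrow> 'r::finite lfun" where
  "rconst r = fps_const (mconst r)"

definition d_rho :: "nat \<Rightarrow> 'r::finite vfield" where
  "d_rho i = (\<lambda>q. if q = Rho i then 1 else 0)"

definition d_theta :: "nat \<Rightarrow> 'r::finite vfield" where
  "d_theta i = (\<lambda>q. if q = Theta i then 1 else 0)"

definition coords :: "nat \<Rightarrow> coord set" where
  "coords n = Rho ` {1..n} \<union> Theta ` {1..n}"

text \<open>
  Partial derivatives of a function of \<open>\<rho> (\<sigma> k)\<close> alone, and the resulting bracket
  \<open>[Y, v] = (DY) v - (Dv) Y\<close>; the bracket does not depend on the coordinates in which it is
  computed, so the polar ones are used.
\<close>

definition pd :: "nat \<Rightarrow> (nat \<Rightarrow> nat) \<Rightarrow> coord \<Rightarrow> 'r::finite lfun \<Rightarrow> 'r lfun" where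
  "pd k \<sigma> q f = (if q = Rho (\<sigma> k) then fps_deriv f else 0)"

definition Dapp :: "nat \<Rightarrow> nat \<Rightarrow> (nat \<Rightarrow> nat) \<Rightarrow> 'r::finite vfield \<Rightarrow> 'r vfield \<Rightarrow> 'r vfield" where
  "Dapp n k \<sigma> Y v = (\<lambda>p. \<Sum>q\<in>coords n. pd k \<sigma> q (Y p) * v q)"

definition brk :: "nat \<Rightarrow> nat \<Rightarrow> (nat \<Rightarrow> nat) \<Rightarrow> 'r::finite vfield \<Rightarrow> 'r vfield \<Rightarrow> 'r vfield" where
  "brk n k \<sigma> Y v = Dapp n k \<sigma> Y v - Dapp n k \<sigma> v Y"

definition Ehat :: "nat \<Rightarrow> (nat \<Rightarrow> nat) \<Rightarrow> (nat \<Rightarrow> real) \<Rightarrow> 'r::finite vfield" where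
  "Ehat k \<sigma> c = (\<Sum>j=1..k. smul (rconst (c (\<sigma> j) / c (\<sigma> k)) * fps_X) (d_rho (\<sigma> j)))"

definition Theta_k :: "nat \<Rightarrow> (nat \<Rightarrow> nat) \<Rightarrow> (nat \<Rightarrow> real) \<Rightarrow> 'r::finite vfield" where
  "Theta_k k \<sigma> \<omega> = (\<Sum>i=1..k. smul (rconst (\<omega> (\<sigma> i))) (d_theta (\<sigma> i)))"

text \<open>\<open>even_ser t\<close> is the series \<open>\<Sum>j. t j * \<rho>^(2j)\<close>.\<close>

definition even_ser :: "(nat \<Rightarrow> 'r mser) \<Rightarrow> 'r::finite lfun" where
  "even_ser t = Abs_fps (\<lambda>d. if even d then t (d div 2) else 0)"

definition leaf_field ::
  "nat \<Rightarrow> (nat \<Rightarrow> nat) \<Rightarrow> (nat \<Rightarrow> real) \<Rightarrow> (nat \<Rightarrow> 'r mser) \<Rightarrow> (nat \<Rightarrow> nat \<Rightarrow> 'r mser) \<Rightarrow> 'r::finite vfield" where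
  "leaf_field k \<sigma> c a b =
     smul (even_ser a) (Ehat k \<sigma> c) + (\<Sum>i=1..k. smul (even_ser (b i)) (d_theta (\<sigma> i)))"

text \<open>The Lie algebra of leaf vector fields; spanning is meant in the formal (infinite) sense.\<close>

definition leaf_alg :: "nat \<Rightarrow> (nat \<Rightarrow> nat) \<Rightarrow> (nat \<Rightarrow> real) \<Rightarrow> 'r::finite vfield set" where
  "leaf_alg k \<sigma> c = {leaf_field k \<sigma> c a b | a b. True}"

text \<open>
  Cartesian form. At a leaf point \<open>p\<close> the frame vectors are
  \<open>\<partial>/\<partial>\<rho> i = (x i, y i) / \<rho> i\<close> and \<open>\<partial>/\<partial>\<theta> i = (- y i, x i)\<close> in the \<open>i\<close>-th plane.
  \<open>has_cartesian_form n k \<sigma> c v F\<close> says that for each parameter exponent \<open>m\<close> the coefficient of \<open>v\<close>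
  is, on the leaf, the vector field \<open>F m\<close>. The leaf is a cone, so this determines
  all components of \<open>v\<close> at the indices \<open>\<sigma> 1, \<dots>, \<sigma> k\<close>.
\<close>

definition cart_term ::
  "nat \<Rightarrow> (nat \<Rightarrow> nat) \<Rightarrow> 'r::finite vfield \<Rightarrow> ('r \<Rightarrow> nat) \<Rightarrow> point \<Rightarrow> nat \<Rightarrow> nat \<Rightarrow> real \<times> real" where
  "cart_term k \<sigma> v m p i d =
     (mcoeff (fps_nth (v (Rho i)) d) m * rho p (\<sigma> k) ^ d)
        *\<^sub>R (fst (p i) / rho p i, snd (p i) / rho p i)
   + (mcoeff (fps_nth (v (Theta i)) d) m * rho p (\<sigma> k) ^ d)
        *\<^sub>R (- snd (p i), fst (p i))"

definition has_cartesian_form ::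
  "nat \<Rightarrow> nat \<Rightarrow> (nat \<Rightarrow> nat) \<Rightarrow> (nat \<Rightarrow> real) \<Rightarrow> 'r::finite vfield
    \<Rightarrow> (('r \<Rightarrow> nat) \<Rightarrow> point \<Rightarrow> nat \<Rightarrow> real \<times> real) \<Rightarrow> bool" where
  "has_cartesian_form n k \<sigma> c v F \<longleftrightarrow>
     (\<forall>p\<in>leaf n k \<sigma> c. \<forall>m. \<forall>i\<in>{1..n}. (\<lambda>d. cart_term k \<sigma> v m p i d) sums F m p i)"

definition d_x :: "nat \<Rightarrow> nat \<Rightarrow> real \<times> real" where
  "d_x i = (\<lambda>l. if l = i then (1, 0) else (0, 0))"

definition d_y :: "nat \<Rightarrow> nat \<Rightarrow> real \<times> real" where
  "d_y i = (\<lambda>l. if l = i then (0, 1) else (0, 0))"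

definition w_cart ::
  "nat \<Rightarrow> (nat \<Rightarrow> nat) \<Rightarrow> nat \<Rightarrow> (nat \<Rightarrow> 'r mser) \<Rightarrow> (nat \<Rightarrow> nat \<Rightarrow> 'r mser)
    \<Rightarrow> ('r \<Rightarrow> nat) \<Rightarrow> point \<Rightarrow> nat \<Rightarrow> real \<times> real" where
  "w_cart k \<sigma> s a b m p l =
     (\<Sum>i=1..k. \<Sum>j=0..s.
        ((fst (p (\<sigma> k)))\<^sup>2 + (snd (p (\<sigma> k)))\<^sup>2) ^ j *\<^sub>R
          ((mcoeff (a j) m * fst (p (\<sigma> i)) - mcoeff (b i j) m * snd (p (\<sigma> i))) *\<^sub>R d_x (\<sigma> i) l
         + (mcoeff (a j) m * snd (p (\<sigma> i)) + mcoeff (b i j) m * fst (p (\<sigma> i))) *\<^sub>R d_y (\<sigma> i) l))"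

text \<open>
  The definitions give the expected structure constants on the leaf algebra (the bracket of two
  \<open>d_theta\<close> terms vanishes), and \<open>Ehat\<close> is the Euler field \<open>x \<partial>/\<partial>x + y \<partial>/\<partial>y\<close> on the leaf.
\<close>

lemma sum_vfield_apply: "(\<Sum>i\<in>A. F i) (q :: coord) = (\<Sum>i\<in>A. F i q :: 'r::finite lfun)"
  by (induct A rule: infinite_finite_induct) auto

lemma Ehat_Rho:
  assumes "\<sigma> permutes {1..n}" "j \<in> {1..k}"
  shows "Ehat k \<sigma> c (Rho (\<sigma> j)) = rconst (c (\<sigma> j) / c (\<sigma> k)) * fps_X"
proof -
  have "\<And>i. \<sigma> j = \<sigma> i \<longleftrightarrow> j = i" using permutes_inj[OF assms(1)] by (auto dest: injD)
  thus ?thesis using assms(2)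
    by (simp add: Ehat_def sum_vfield_apply smul_def d_rho_def if_distrib sum.delta cong: if_cong)
qed

lemma Ehat_Theta: "Ehat k \<sigma> c (Theta i) = 0"
  by (simp add: Ehat_def sum_vfield_apply smul_def d_rho_def)

lemma rconst_1: "rconst 1 = (1 :: 'r::finite lfun)"
proof -
  have "mconst 1 = (1 :: 'r mser)" by (rule mser_eqI) (simp add: mconst_def one_mser_def)
  thus ?thesis by (simp add: rconst_def)
qed

lemma Dapp_eq:
  assumes "\<sigma> k \<in> {1..n}"
  shows "Dapp n k \<sigma> Y v = (\<lambda>p. fps_deriv (Y p) * v (Rho (\<sigma> k)))"
proof
  fix p
  have "finite (coords n)" "Rho (\<sigma> k) \<in> coords n" using assms by (auto simp: coords_def)
  thus "Dapp n k \<sigma> Y v p = fps_deriv (Y p) * v (Rho (\<sigma> k))"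
    by (simp add: Dapp_def pd_def if_distrib[of "\<lambda>x. x * _"] sum.delta' cong: if_cong)
qed

lemma Ehat_Rho_k:
  assumes "\<sigma> permutes {1..n}" "1 \<le> k" "k \<le> n" "c (\<sigma> k) > 0"
  shows "Ehat k \<sigma> c (Rho (\<sigma> k)) = fps_X"
  using Ehat_Rho[OF assms(1), of k k c] assms by (simp add: rconst_1)

lemma deriv_Ehat: "fps_deriv (Ehat k \<sigma> c q) * fps_X = Ehat k \<sigma> c q"
  unfolding Ehat_def sum_vfield_apply smul_def d_rho_def fps_deriv_sum sum_distrib_right
  by (rule sum.cong) (auto simp: rconst_def)

lemma brk_Ehat_Ehat:
  assumes "\<sigma> permutes {1..n}" "1 \<le> k" "k \<le> n" "c (\<sigma> k) > 0"
  shows "brk n k \<sigma> (smul f (Ehat k \<sigma> c)) (smul g (Ehat k \<sigma> c))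
       = smul (fps_X * (fps_deriv f * g - fps_deriv g * f)) (Ehat k \<sigma> c)"
proof -
  have "\<sigma> k \<in> {1..n}" using assms permutes_in_image by force
  note D = Dapp_eq[where \<sigma> = \<sigma> and k = k, OF this]
  show ?thesis unfolding brk_def D smul_def Ehat_Rho_k[where \<sigma> = \<sigma> and k = k and c = c, OF assms]
    by (rule ext) (simp add: algebra_simps)
qed

lemma brk_d_theta_Ehat:
  assumes "\<sigma> permutes {1..n}" "1 \<le> k" "k \<le> n" "c (\<sigma> k) > 0"
  shows "brk n k \<sigma> (smul f (d_theta i)) (smul g (Ehat k \<sigma> c))
       = smul (fps_X * fps_deriv f * g) (d_theta i)"
proof -
  have "\<sigma> k \<in> {1..n}" using assms permutes_in_image by force
  note D = Dapp_eq[where \<sigma> = \<sigma> and k = k, OF this]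
  show ?thesis unfolding brk_def D smul_def Ehat_Rho_k[where \<sigma> = \<sigma> and k = k and c = c, OF assms]
    by (rule ext) (auto simp: d_theta_def algebra_simps)
qed

lemma cart_term_Ehat:
  assumes "\<sigma> permutes {1..n}" "p \<in> leaf n k \<sigma> c" "i \<in> {1..k}"
  shows "cart_term k \<sigma> (Ehat k \<sigma> c :: 'r::finite vfield) m p (\<sigma> i) d
       = (if d = 1 \<and> m = 0 then p (\<sigma> i) else 0)"
proof -
  have r: "rho p (\<sigma> i) = c (\<sigma> i) / c (\<sigma> k) * rho p (\<sigma> k)" "rho p (\<sigma> i) > 0"
    using assms unfolding leaf_def by blast+
  have z: "mcoeff (0 :: 'r mser) m = 0" for m by (simp add: zero_mser_def)
  show ?thesis using r unfolding cart_term_def Ehat_Rho[OF assms(1,3)] Ehat_Theta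
    by (auto simp: rconst_def mconst_def z prod_eq_iff)
qed

section \<open>State changes and time rescaling\<close>

text \<open>
  Coefficientwise sum of a sequence of formal vector fields. In all uses below, each coefficient
  receives only finitely many nonzero contributions.
\<close>

definition formal_sums :: "(nat \<Rightarrow> 'r::finite vfield) \<Rightarrow> 'r vfield \<Rightarrow> bool" where
  "formal_sums V v \<longleftrightarrow>
     (\<forall>q d m. (\<lambda>i. mcoeff (fps_nth (V i q) d) m) sums mcoeff (fps_nth (v q) d) m)"

text \<open>
  Generators of near-identity changes: no constant multiple of \<open>Ehat\<close> (whose flow is a dilation)
  and none of the \<open>d_theta\<close> (whose flow is a rotation), at parameter value zero.
\<close>

definition near_id_generator :: "nat \<Rightarrow> (nat \<Rightarrow> nat) \<Rightarrow> (nat \<Rightarrow> real) \<Rightarrow> 'r::finite vfield \<Rightarrow> bool" where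
  "near_id_generator k \<sigma> c S \<longleftrightarrow>
     (\<exists>a b. S = leaf_field k \<sigma> c a b \<and> at_zero (a 0) = 0 \<and> (\<forall>i\<in>{1..k}. at_zero (b i 0) = 0))"

definition time_rescaling :: "'r::finite lfun \<Rightarrow> bool" where
  "time_rescaling T \<longleftrightarrow> (\<exists>t. T = even_ser t \<and> at_zero (t 0) = 0)"

text \<open>
  State changes act on vector fields by the exponential of \<open>ad\<close>: \<open>is_exp_ad n k \<sigma> S v w\<close>: \<open>w\<close> is
  \<open>exp (ad S) v\<close>.
\<close>

definition is_exp_ad ::
  "nat \<Rightarrow> nat \<Rightarrow> (nat \<Rightarrow> nat) \<Rightarrow> 'r::finite vfield \<Rightarrow> 'r vfield \<Rightarrow> 'r vfield \<Rightarrow> bool" where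
  "is_exp_ad n k \<sigma> S v w \<longleftrightarrow>
     formal_sums (\<lambda>l. smul (rconst (1 / fact l)) ((brk n k \<sigma> S ^^ l) v)) w"


section \<open>Grading and infinite-level normal forms\<close>

definition leaf_grade ::
  "nat \<Rightarrow> (nat \<Rightarrow> nat) \<Rightarrow> (nat \<Rightarrow> real) \<Rightarrow> nat \<Rightarrow> nat \<Rightarrow> 'r::finite vfield set" where
  "leaf_grade k \<sigma> c s g = {leaf_field k \<sigma> c a b | a b.
     (\<forall>j m. mcoeff (a j) m \<noteq> 0 \<longrightarrow> mdeg m * (s + 1) + j = g) \<and>
     (\<forall>i\<in>{1..k}. \<forall>j m. mcoeff (b i j) m \<noteq> 0 \<longrightarrow> mdeg m * (s + 1) + s + j = g)}"

definition time_grade :: "nat \<Rightarrow> nat \<Rightarrow> 'r::finite lfun set" where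
  "time_grade s g = {even_ser t | t. \<forall>j m. mcoeff (t j) m \<noteq> 0 \<longrightarrow> mdeg m * (s + 1) + j = g}"

text \<open>
  The maps \<open>d^(i,r)\<close> for the graded field \<open>V\<close>. The tuple \<open>(T_(i-r+1), \<dots>, T_i, S_(i-r+1), \<dots>, S_i)\<close>
  is given by functions of the grade; only these entries matter. The value \<open>r = 0\<close> is only an
  anchor for the recursion (no condition, empty sum).
\<close>

definition dmap ::
  "nat \<Rightarrow> nat \<Rightarrow> (nat \<Rightarrow> nat) \<Rightarrow> (nat \<Rightarrow> 'r::finite vfield) \<Rightarrow> nat \<Rightarrow> nat
    \<Rightarrow> (nat \<Rightarrow> 'r lfun) \<Rightarrow> (nat \<Rightarrow> 'r vfield) \<Rightarrow> 'r vfield" where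
  "dmap n k \<sigma> V i r T S = (\<Sum>j<r. smul (T (i - j)) (V j) + brk n k \<sigma> (S (i - j)) (V j))"

fun ddom ::
  "nat \<Rightarrow> nat \<Rightarrow> (nat \<Rightarrow> nat) \<Rightarrow> (nat \<Rightarrow> real) \<Rightarrow> nat \<Rightarrow> (nat \<Rightarrow> 'r::finite vfield) \<Rightarrow> nat \<Rightarrow> nat
    \<Rightarrow> (nat \<Rightarrow> 'r lfun) \<Rightarrow> (nat \<Rightarrow> 'r vfield) \<Rightarrow> bool" where
  "ddom n k \<sigma> c s V i 0 T S \<longleftrightarrow> True"
| "ddom n k \<sigma> c s V i (Suc r) T S \<longleftrightarrow>
     T i \<in> time_grade s i \<and> S i \<in> leaf_grade k \<sigma> c s i \<and>
     ddom n k \<sigma> c s V (i - 1) r T S \<and> dmap n k \<sigma> V (i - 1) r T S = 0"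

definition dimage ::
  "nat \<Rightarrow> nat \<Rightarrow> (nat \<Rightarrow> nat) \<Rightarrow> (nat \<Rightarrow> real) \<Rightarrow> nat \<Rightarrow> (nat \<Rightarrow> 'r::finite vfield) \<Rightarrow> nat \<Rightarrow> nat
    \<Rightarrow> 'r vfield set" where
  "dimage n k \<sigma> c s V i r = {dmap n k \<sigma> V i r T S | T S. ddom n k \<sigma> c s V i r T S}"

text \<open>\<open>U\<close> is the direct sum of \<open>W\<close> and the real subspace \<open>C\<close>.\<close>

definition is_complement ::
  "'r::finite vfield set \<Rightarrow> 'r vfield set \<Rightarrow> 'r vfield set \<Rightarrow> bool" where
  "is_complement U W C \<longleftrightarrow>
     0 \<in> C \<and> (\<forall>u\<in>C. \<forall>v\<in>C. u + v \<in> C) \<and> (\<forall>r. \<forall>u\<in>C. smul (rconst r) u \<in> C) \<and>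
     W \<inter> C = {0} \<and> {w + u | w u. w \<in> W \<and> u \<in> C} = U"

text \<open>
  Normal form with respect to a family \<open>\<C>\<close> of complements, which is a parameter so that it can be
  fixed before the vector field to be normalised; \<open>V\<close> is the graded decomposition of \<open>w\<close>.
\<close>

definition infinite_level_nf ::
  "nat \<Rightarrow> nat \<Rightarrow> (nat \<Rightarrow> nat) \<Rightarrow> (nat \<Rightarrow> real) \<Rightarrow> nat \<Rightarrow> (nat \<Rightarrow> 'r::finite vfield set)
    \<Rightarrow> 'r vfield \<Rightarrow> bool" where
  "infinite_level_nf n k \<sigma> c s \<C> w \<longleftrightarrow>
     (\<exists>V. (\<forall>i. V i \<in> leaf_grade k \<sigma> c s i) \<and> formal_sums V w \<and>
        (\<forall>i\<ge>1. is_complement (leaf_grade k \<sigma> c s i) (dimage n k \<sigma> c s V i i) (\<C> i)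
              \<and> V i \<in> \<C> i))"

end

theory Submission
  imports Defs
begin

text \<open>
  Put \<open>z = \<rho> (\<sigma> k)\<^sup>2\<close> and write a leaf field as \<open>A(z) Ehat + \<Sum>i. B i(z) \<Theta> i\<close>, with coefficients
  that are power series in \<open>z\<close> and \<open>\<mu>\<close>. Since \<open>Ehat\<close> acts on functions of \<open>z\<close> as \<open>D = 2 z d/dz\<close> and
  the \<open>\<Theta> i\<close> act as zero, a generator \<open>f Ehat + \<Sum>i. h i \<Theta> i\<close> and a rescaling \<open>T\<close> change the field
  infinitesimally by \<open>T A + A D f - f D A\<close> in the direction of \<open>Ehat\<close> and by
  \<open>T B i + A D(h i) - f D(B i)\<close> in the direction of \<open>\<Theta> i\<close>.

  The lowest part of the field has grade \<open>s\<close>: it is \<open>\<alpha> z^s Ehat + \<Sum>i. e i \<Theta> i\<close>, where \<open>\<alpha>\<close> is the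
  value of \<open>a s\<close> at zero and \<open>e i = \<omega> (\<sigma> i)\<close>. Linearising the action there couples only
  coefficients that belong to one parameter monomial, and \<open>T = \<tau> z^j\<close>, \<open>f = \<phi> z^j\<close>,
  \<open>h i = \<eta> i z^(j - s)\<close> (absent if \<open>j < s\<close>) produce
  \<open>\<alpha> (\<tau> + 2 (j - s) \<phi>) z^(j + s) Ehat + \<Sum>i. (e i \<tau> + 2 \<alpha> (j - s) \<eta> i) z^j \<Theta> i\<close>.
  So in grades above \<open>s\<close> one can remove all \<open>z^(j + s) Ehat\<close> (with \<open>\<phi>\<close>, but with \<open>\<tau>\<close> when
  \<open>j = s\<close>), all \<open>z^j \<Theta> i\<close> with \<open>j > s\<close> (with \<open>\<eta> i\<close>), and, spending \<open>\<tau>\<close>, the terms \<open>z^j \<Theta> 1\<close>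
  with \<open>j < s\<close>. What remains is the shape of the normal form. The set of removed positions does
  not depend on \<open>\<alpha>\<close>, so one family of complements serves all fields with the same \<open>s\<close>.

  The normalising transformation exists because the exponential of \<open>ad S\<close> differs from its
  linearisation only in higher grades. With the right inverse of the linearised action
  (lemma \<open>cf_act_sol\<close>) the equation "all removed coefficients vanish" becomes a fixed point
  equation for a map that contracts the grading filtration (lemma
  \<open>normalising_transformation_exists\<close>); a single generator \<open>S\<close> is obtained, so no composition of
  exponentials is needed.

  The normal form is one of infinite level because nothing further can be removed. The
  image of \<open>d^(i,i)\<close> consists of the lowest-order parts, in grade \<open>i\<close>, of \<open>T W + [S, W]\<close> for the
  normalised field \<open>W\<close>. A pair \<open>(T, S)\<close> on which the linearised action vanishes is the leading
  part of a pair on which the full action vanishes, namely \<open>T = - A D g\<close> and \<open>S\<close> equal to \<open>g W\<close> plus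
  multiples of the \<open>\<Theta> i\<close> with coefficients in the parameters alone (\<open>A\<close> the \<open>Ehat\<close> part of \<open>W\<close>).
  Subtracting such pairs raises the order of \<open>(T, S)\<close> until only the
  linearised action contributes to grade \<open>i\<close> (lemmas \<open>raise_order\<close> and \<open>initial_part_trivial\<close>).
  Hence the image is the one computed above, and the remaining terms form a complement of it
  (lemma \<open>is_complement_nf\<close>).
\<close>

section \<open>Series in the parameters and the squared radius\<close>

definition sc :: "'r::finite mser fps \<Rightarrow> nat \<Rightarrow> ('r \<Rightarrow> nat) \<Rightarrow> real" where
  "sc f j m = mcoeff (fps_nth f j) m"

lemma ser_eqI: "(\<And>j m. sc f j m = sc g j m) \<Longrightarrow> f = g"
  by (auto intro!: fps_ext mser_eqI simp: sc_def)

lemma sc_0 [simp]: "sc 0 j m = 0"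
  and sc_add [simp]: "sc (f + g) j m = sc f j m + sc g j m"
  and sc_diff [simp]: "sc (f - g) j m = sc f j m - sc g j m"
  by (simp_all add: sc_def zero_mser_def plus_mser_def minus_mser_def)

lemma sc_Abs [simp]: "sc (Abs_fps (\<lambda>j. Abs_mser (f j))) j m = f j m"
  by (simp add: sc_def)

lemma mcoeff_0 [simp]: "mcoeff (0 :: 'r::finite mser) m = 0"
  by (simp add: zero_mser_def)

lemma mcoeff_add [simp]: "mcoeff (f + g) m = mcoeff f m + mcoeff (g :: 'r::finite mser) m"
  by (simp add: plus_mser_def)

lemma mcoeff_sum: "mcoeff (\<Sum>x\<in>A. f x :: 'r::finite mser) m = (\<Sum>x\<in>A. mcoeff (f x) m)"
  by (induct A rule: infinite_finite_induct) auto

lemma sc_mult: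
  "sc (f * g) j m = (\<Sum>l\<le>j. \<Sum>(a, b)\<in>splits m. sc f l a * sc g (j - l) b)"
  unfolding sc_def fps_mult_nth mcoeff_sum times_mser_def mcoeff_Abs atLeast0AtMost ..

text \<open>
  A coefficient of a product only sees pairs of coefficients of complementary position; this is
  why products respect the grading.
\<close>

lemma sc_mult_cong:
  assumes "\<And>j1 j2 m1 m2. j1 + j2 = j \<Longrightarrow> m1 + m2 = m \<Longrightarrow>
    sc f j1 m1 * sc g j2 m2 = sc f' j1 m1 * sc g' j2 m2"
  shows "sc (f * g) j m = sc (f' * g') j m"
  unfolding sc_mult by (intro sum.cong) (auto simp: splits_def intro!: assms)

lemma mcoeff_mconst_mult [simp]: "mcoeff (mconst r * f) m = r * mcoeff (f :: 'r::finite mser) m"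
proof -
  have "(\<Sum>(a, b)\<in>splits m. mcoeff (mconst r) a * mcoeff f b)
      = (\<Sum>(a, b)\<in>{(0 :: 'r \<Rightarrow> nat, m)}. mcoeff (mconst r) a * mcoeff f b)"
    by (rule sum.mono_neutral_right) (simp, auto simp: splits_def mconst_def split: if_splits)
  thus ?thesis by (simp add: times_mser_def mconst_def)
qed

lemma sc_const_mult [simp]: "sc (fps_const (mconst r) * f) j m = r * sc f j m"
  by (simp add: sc_def)

lemma sc_X_power_mult: "sc (fps_X ^ p * f) j m = (if j < p then 0 else sc f (j - p) m)"
  by (simp add: sc_def fps_X_power_mult_nth)

text \<open>The Euler operator \<open>\<rho> d/d\<rho> = 2 z d/dz\<close> in the variable \<open>z = \<rho>\<^sup>2\<close>.\<close>

definition eul :: "'r::finite mser fps \<Rightarrow> 'r mser fps" where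
  "eul f = fps_X * fps_deriv f + fps_X * fps_deriv f"

lemma mcoeff_of_nat_mult [simp]:
  "mcoeff (of_nat l * f) m = real l * mcoeff (f :: 'r::finite mser) m"
  by (induct l) (simp_all add: distrib_right)

lemma sc_eul [simp]: "sc (eul f) j m = 2 * real j * sc f j m"
proof (cases j)
  case (Suc i)
  have "mcoeff ((of_nat (Suc i)) * fps_nth f (Suc i)) m = real (Suc i) * mcoeff (fps_nth f (Suc i)) m"
    by (rule mcoeff_of_nat_mult)
  moreover have "fps_nth (eul f) (Suc i)
      = of_nat (Suc i) * fps_nth f (Suc i) + of_nat (Suc i) * fps_nth f (Suc i)"
    by (simp add: eul_def)
  ultimately show ?thesis using Suc unfolding sc_def by (simp only: mcoeff_add)
qed (simp add: eul_def sc_def)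

lemma eul_diff [simp]: "eul (f - g) = eul f - eul g"
  and eul_add [simp]: "eul (f + g) = eul f + eul g"
  and eul_0 [simp]: "eul 0 = 0"
  and eul_const [simp]: "eul (fps_const x) = 0"
  and eul_mult: "eul (f * g) = eul f * g + f * eul g"
  by (auto simp: eul_def algebra_simps)


section \<open>Fields, their bracket and their grading\<close>

text \<open>
  A leaf field \<open>A(\<rho>\<^sup>2) Ehat + \<Sum>i. B i(\<rho>\<^sup>2) d_theta (\<sigma> i)\<close> is encoded by the sequence of series
  \<open>A, B 1, B 2, \<dots>\<close>. With \<open>Ehat\<close> at index 0 the bracket has one formula for all components.
\<close>

type_synonym 'r fld = "nat \<Rightarrow> 'r mser fps"

definition cf :: "'r::finite fld \<Rightarrow> nat \<Rightarrow> nat \<Rightarrow> ('r \<Rightarrow> nat) \<Rightarrow> real" where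
  "cf F i j m = sc (F i) j m"

definition mk_fld :: "(nat \<Rightarrow> nat \<Rightarrow> ('r \<Rightarrow> nat) \<Rightarrow> real) \<Rightarrow> 'r::finite fld" where
  "mk_fld f = (\<lambda>i. Abs_fps (\<lambda>j. Abs_mser (f i j)))"

lemma cf_mk_fld [simp]: "cf (mk_fld f) i j m = f i j m"
  by (simp add: cf_def mk_fld_def)

lemma cf_0 [simp]: "cf 0 i j m = 0"
  and cf_add [simp]: "cf (F + G) i j m = cf F i j m + cf G i j m"
  and cf_diff [simp]: "cf (F - G) i j m = cf F i j m - cf G i j m"
  by (simp_all add: cf_def)

lemma fld_eqI: "(\<And>i j m. cf F i j m = cf G i j m) \<Longrightarrow> F = G"
  by (auto intro!: ext ser_eqI simp: cf_def)

definition tmul :: "'r::finite mser fps \<Rightarrow> 'r fld \<Rightarrow> 'r fld" where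
  "tmul f F = (\<lambda>i. f * F i)"

definition bk :: "'r::finite fld \<Rightarrow> 'r fld \<Rightarrow> 'r fld" where
  "bk Y W = (\<lambda>i. W 0 * eul (Y i) - Y 0 * eul (W i))"

text \<open>The infinitesimal action of a time rescaling and a state change on \<open>W\<close>.\<close>

definition act :: "'r::finite mser fps \<Rightarrow> 'r fld \<Rightarrow> 'r fld \<Rightarrow> 'r fld" where
  "act T S W = tmul T W + bk S W"

lemma bk_diff_left: "bk (Y - Y') W = bk Y W - bk Y' W"
  and bk_diff_right: "bk Y (W - W') = bk Y W - bk Y W'"
  and bk_add_left: "bk (Y + Y') W = bk Y W + bk Y' W"
  and tmul_diff_left: "tmul (f - f') W = tmul f W - tmul f' W"
  and tmul_diff_right: "tmul f (W - W') = tmul f W - tmul f W'"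
  and tmul_add_left: "tmul (f + f') W = tmul f W + tmul f' W"
  by (auto simp: bk_def tmul_def algebra_simps)

lemma act_diff_right: "act T S (W - W') = act T S W - act T S W'"
  and act_diff_left: "act (T - T') (S - S') W = act T S W - act T' S' W"
  and act_add_left: "act (T + T') (S + S') W = act T S W + act T' S' W"
  by (auto simp: act_def bk_diff_right tmul_diff_right bk_diff_left tmul_diff_left
      bk_add_left tmul_add_left algebra_simps)

definition wt :: "nat \<Rightarrow> nat \<Rightarrow> ('r::finite \<Rightarrow> nat) \<Rightarrow> nat" where
  "wt s j m = mdeg m * (s + 1) + j"

text \<open>
  The grade of the monomial \<open>\<mu>^m z^j\<close> in component \<open>i\<close>: rotations are shifted by \<open>s\<close>, so that
  the frequencies and \<open>z^s Ehat\<close> have equal grade.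
\<close>

definition gdeg :: "nat \<Rightarrow> nat \<Rightarrow> nat \<Rightarrow> ('r::finite \<Rightarrow> nat) \<Rightarrow> nat" where
  "gdeg s i j m = wt s j m + (if i = 0 then 0 else s)"

lemma mdeg_add: "mdeg (a + b) = mdeg a + mdeg b"
  by (simp add: mdeg_def sum.distrib)

lemma mdeg_eq_0_iff: "mdeg m = 0 \<longleftrightarrow> m = 0"
  by (auto simp: mdeg_def fun_eq_iff)

lemma mdeg_0 [simp]: "mdeg 0 = 0"
  by (simp add: mdeg_def)

lemma wt_add: "wt s (j1 + j2) (m1 + m2) = wt s j1 m1 + wt s j2 m2"
  by (simp add: wt_def mdeg_add algebra_simps)

text \<open>
  \<open>ord_ge s\<close> and \<open>fil s\<close> are the decreasing filtrations by the grade, on series (time rescalings)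
  and on fields.
\<close>

definition ord_ge :: "nat \<Rightarrow> nat \<Rightarrow> 'r::finite mser fps \<Rightarrow> bool" where
  "ord_ge s g f \<longleftrightarrow> (\<forall>j m. wt s j m < g \<longrightarrow> sc f j m = 0)"

definition fil :: "nat \<Rightarrow> nat \<Rightarrow> 'r::finite fld \<Rightarrow> bool" where
  "fil s g F \<longleftrightarrow> (\<forall>i j m. gdeg s i j m < g \<longrightarrow> cf F i j m = 0)"

lemma fil_iff_ord: "fil s g F \<longleftrightarrow> (\<forall>i. ord_ge s (if i = 0 then g else g - s) (F i))"
  by (auto simp: fil_def ord_ge_def gdeg_def cf_def less_diff_conv)

lemma ord_ge_mono: "ord_ge s g f \<Longrightarrow> h \<le> g \<Longrightarrow> ord_ge s h f"
  by (auto simp: ord_ge_def)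

lemma fil_mono: "fil s g F \<Longrightarrow> h \<le> g \<Longrightarrow> fil s h F"
  by (auto simp: fil_def)

lemma ord_ge_0 [simp]: "ord_ge s 0 f"
  and fil_0 [simp]: "fil s 0 F"
  and fil_zero [simp]: "fil s g 0"
  by (auto simp: ord_ge_def fil_def)

lemma ord_ge_diff: "ord_ge s g f \<Longrightarrow> ord_ge s g f' \<Longrightarrow> ord_ge s g (f - f')"
  and ord_ge_add: "ord_ge s g f \<Longrightarrow> ord_ge s g f' \<Longrightarrow> ord_ge s g (f + f')"
  and ord_ge_eul: "ord_ge s g f \<Longrightarrow> ord_ge s g (eul f)"
  by (auto simp: ord_ge_def)

lemma fil_diff: "fil s g F \<Longrightarrow> fil s g F' \<Longrightarrow> fil s g (F - F')"
  and fil_add: "fil s g F \<Longrightarrow> fil s g F' \<Longrightarrow> fil s g (F + F')"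
  by (auto simp: fil_def)

lemma ord_ge_mult:
  assumes "ord_ge s g f" "ord_ge s h f'"
  shows "ord_ge s (g + h) (f * f')"
  unfolding ord_ge_def
proof (intro allI impI)
  fix j and m :: "'a \<Rightarrow> nat" assume "wt s j m < g + h"
  then have "sc (f * f') j m = sc (0 * 0 :: 'a mser fps) j m"
    using assms unfolding ord_ge_def
    by (intro sc_mult_cong) (metis add_mono_thms_linordered_semiring(1) leD leI mult_zero_left
        mult_zero_right sc_0 wt_add)
  then show "sc (f * f') j m = 0" by simp
qed

lemma fil_tmul:
  assumes "ord_ge s g f" "fil s h F"
  shows "fil s (g + h) (tmul f F)"
  unfolding fil_iff_ord tmul_def
proof
  fix i
  show "ord_ge s (if i = 0 then g + h else g + h - s) (f * F i)"
    using assms ord_ge_mono[OF ord_ge_mult, of s g f "if i = 0 then h else h - s" "F i"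
        "if i = 0 then g + h else g + h - s"]
    unfolding fil_iff_ord by auto
qed

text \<open>
  The shift by \<open>s\<close> is harmless because both products in a rotational component of the bracket
  contain exactly one rotational factor.
\<close>

lemma fil_bk:
  assumes "fil s g Y" "fil s h W"
  shows "fil s (g + h) (bk Y W)"
  unfolding fil_iff_ord bk_def
proof (intro allI ord_ge_diff)
  fix i
  have Y: "ord_ge s g (Y 0)" "ord_ge s (if i = 0 then g else g - s) (eul (Y i))"
    and W: "ord_ge s h (W 0)" "ord_ge s (if i = 0 then h else h - s) (eul (W i))"
    using assms unfolding fil_iff_ord by (metis ord_ge_eul)+
  show "ord_ge s (if i = 0 then g + h else g + h - s) (W 0 * eul (Y i))"
    by (rule ord_ge_mono[OF ord_ge_mult[OF W(1) Y(2)]]) auto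
  show "ord_ge s (if i = 0 then g + h else g + h - s) (Y 0 * eul (W i))"
    by (rule ord_ge_mono[OF ord_ge_mult[OF Y(1) W(2)]]) auto
qed

lemma fil_act: "ord_ge s g T \<Longrightarrow> fil s g S \<Longrightarrow> fil s h W \<Longrightarrow> fil s (g + h) (act T S W)"
  by (simp add: act_def fil_add fil_tmul fil_bk)

lemma fil_eqI: "(\<And>g. fil s g (F - G)) \<Longrightarrow> F = G"
  by (rule fld_eqI) (metis cf_diff fil_def lessI eq_iff_diff_eq_0)

lemma fil_sum: "(\<And>x. x \<in> A \<Longrightarrow> fil s g (F x)) \<Longrightarrow> fil s g (\<Sum>x\<in>A. F x)"
  by (induct A rule: infinite_finite_induct) (auto intro: fil_add)

text \<open>
  A map that improves agreement by one grade has a fixed point: each coefficient of the iterates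
  becomes stationary.
\<close>

lemma fil_contraction_fixpoint:
  fixes \<Phi> :: "'r::finite fld \<Rightarrow> 'r fld"
  assumes "\<And>g U U'. fil s g (U - U') \<Longrightarrow> fil s (g + 1) (\<Phi> U - \<Phi> U')"
  shows "\<exists>U. \<Phi> U = U"
proof -
  define X where "X n = (\<Phi> ^^ n) 0" for n
  have X: "X (Suc n) = \<Phi> (X n)" for n by (simp add: X_def)
  have step: "fil s n (X (Suc n) - X n)" for n
  proof (induct n)
    case (Suc n)
    have "fil s (n + 1) (\<Phi> (X (Suc n)) - \<Phi> (X n))" by (rule assms[OF Suc])
    then show ?case by (subst (1 2) X) simp
  qed (rule fil_0)
  have stable: "cf (X n) i j m = cf (X (Suc (gdeg s i j m))) i j m" if "gdeg s i j m < n" for n i j m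
    using that
  proof (induct n)
    case (Suc n)
    show ?case
    proof (cases "gdeg s i j m = n")
      case False
      with Suc have "gdeg s i j m < n" by simp
      then show ?thesis using Suc.hyps step[of n] unfolding fil_def by (metis cf_diff eq_iff_diff_eq_0)
    qed (simp only:)
  qed simp
  define U where "U = (mk_fld (\<lambda>i j m. cf (X (Suc (gdeg s i j m))) i j m) :: 'r fld)"
  have close: "fil s n (U - X n)" for n
    unfolding fil_def
  proof (intro allI impI)
    fix i j and m :: "'r \<Rightarrow> nat" assume "gdeg s i j m < n"
    from stable[OF this] show "cf (U - X n) i j m = 0" by (simp add: U_def)
  qed
  have "\<Phi> U = U"
  proof (rule fil_eqI)
    fix g
    have "fil s g (\<Phi> U - X (Suc g))" using assms[OF close[of g]] by (auto simp: X intro: fil_mono)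
    moreover have "fil s g (U - X (Suc g))" using close[of "Suc g"] by (rule fil_mono) simp
    ultimately have "fil s g ((\<Phi> U - X (Suc g)) - (U - X (Suc g)))" by (rule fil_diff)
    then show "fil s g (\<Phi> U - U)" by simp
  qed
  then show ?thesis by blast
qed


section \<open>The linearised action and its right inverse\<close>

definition lead :: "nat \<Rightarrow> real \<Rightarrow> (nat \<Rightarrow> real) \<Rightarrow> 'r::finite fld" where
  "lead s \<alpha> e = (\<lambda>i. if i = 0 then fps_const (mconst \<alpha>) * fps_X ^ s else fps_const (mconst (e i)))"

lemma sc_X_power: "sc (fps_X ^ s) j m = (if j = s \<and> m = 0 then 1 else 0)"
  by (simp add: sc_def fps_X_power_iff one_mser_def)

lemma sc_const: "sc (fps_const (mconst r)) j m = (if j = 0 \<and> m = 0 then r else 0)"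
  by (simp add: sc_def mconst_def)

lemma cf_lead: "cf (lead s \<alpha> e) i j m =
    (if m = 0 \<and> j = (if i = 0 then s else 0) then if i = 0 then \<alpha> else e i else 0)"
  by (simp add: cf_def lead_def sc_X_power sc_const)

lemma fil_lead: "fil s s (lead s \<alpha> e)"
  by (auto simp: fil_def cf_lead gdeg_def wt_def)

text \<open>
  The lowest part \<open>lead s \<alpha> e\<close> is a monomial in each component, so its action moves
  coefficients without mixing them. The factor \<open>2 (j - s) - 2 s\<close> vanishes at \<open>j = 2 s\<close>
  because the generator \<open>z^s Ehat\<close> commutes with itself.
\<close>

lemma cf_act_lead_0: "cf (act T S (lead s \<alpha> e)) 0 j m =
    (if j < s then 0
     else \<alpha> * (sc T (j - s) m + (2 * real (j - s) - 2 * real s) * cf S 0 (j - s) m))"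
proof -
  have eul: "eul (lead s \<alpha> e 0 :: 'a mser fps) = fps_const (mconst (2 * real s * \<alpha>)) * fps_X ^ s"
    by (rule ser_eqI) (simp add: lead_def sc_X_power)
  have "act T S (lead s \<alpha> e) 0
      = fps_const (mconst \<alpha>) * (fps_X ^ s * (T + eul (S 0)))
        - fps_const (mconst (2 * real s * \<alpha>)) * (fps_X ^ s * S 0)"
    unfolding act_def tmul_def bk_def plus_fun_def eul by (simp add: lead_def algebra_simps)
  from this show ?thesis unfolding cf_def
    by (simp only: sc_diff sc_const_mult sc_X_power_mult sc_add sc_eul) (simp add: algebra_simps)
qed

lemma cf_act_lead_pos: "i > 0 \<Longrightarrow> cf (act T S (lead s \<alpha> e)) i j m =
    e i * sc T j m + (if j < s then 0 else 2 * \<alpha> * real (j - s) * cf S i (j - s) m)"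
proof -
  assume i: "i > 0"
  then have "act T S (lead s \<alpha> e) i
      = fps_const (mconst (e i)) * T + fps_const (mconst \<alpha>) * (fps_X ^ s * eul (S i))"
    unfolding act_def tmul_def bk_def plus_fun_def by (simp add: lead_def algebra_simps)
  then show ?thesis by (simp add: cf_def sc_X_power_mult)
qed

text \<open>
  The positions cleared in grades above \<open>s\<close>. In particular \<open>z^s Ehat\<close> only loses the
  parameter-dependent part of its coefficient; the value at zero has grade \<open>s\<close> and stays.
\<close>

definition removed :: "nat \<Rightarrow> nat \<Rightarrow> nat \<Rightarrow> bool" where
  "removed s i j \<longleftrightarrow> (i = 0 \<and> s \<le> j) \<or> (i = 1 \<and> j < s) \<or> (0 < i \<and> s < j)"

text \<open>
  A right inverse of the linearised action on the removed positions. Time rescaling is used only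
  where nothing else helps: up to \<open>z^(s - 1)\<close> for the first rotation, and at \<open>z^s\<close> for
  \<open>z^(2 s) Ehat\<close>, which the state changes cannot reach.
\<close>

definition solT :: "nat \<Rightarrow> real \<Rightarrow> (nat \<Rightarrow> real) \<Rightarrow> 'r::finite fld \<Rightarrow> 'r mser fps" where
  "solT s \<alpha> e U = Abs_fps (\<lambda>j. Abs_mser (\<lambda>m.
     if j < s then cf U 1 j m / e 1 else if j = s then cf U 0 (2 * s) m / \<alpha> else 0))"

definition solS :: "nat \<Rightarrow> real \<Rightarrow> (nat \<Rightarrow> real) \<Rightarrow> 'r::finite fld \<Rightarrow> 'r fld" where
  "solS s \<alpha> e U = mk_fld (\<lambda>i j m.
     if i = 0 then
       if j = s then 0
       else (cf U 0 (j + s) m / \<alpha> - sc (solT s \<alpha> e U) j m) / (2 * real j - 2 * real s)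
     else if j = 0 then 0 else cf U i (j + s) m / (2 * \<alpha> * real j))"

lemma sc_solT: "sc (solT s \<alpha> e U) j m =
    (if j < s then cf U 1 j m / e 1 else if j = s then cf U 0 (2 * s) m / \<alpha> else 0)"
  by (simp add: solT_def)

lemma cf_act_sol:
  assumes "\<alpha> \<noteq> 0" "e 1 \<noteq> 0" "removed s i j"
  shows "cf (act (solT s \<alpha> e U) (solS s \<alpha> e U) (lead s \<alpha> e)) i j m = cf U i j m"
proof (cases "i = 0")
  case True
  with assms obtain l where l: "j = l + s" by (auto simp: removed_def dest: le_Suc_ex)
  show ?thesis
  proof (cases "l = s")
    case False
    then have "2 * real l - 2 * real s \<noteq> 0" by simp
    then show ?thesis using True l False assms
      by (simp add: cf_act_lead_0 solS_def)
  next
    case True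
    then have "j = 2 * s" using l by simp
    then show ?thesis using \<open>i = 0\<close> assms by (simp add: cf_act_lead_0 sc_solT)
  qed
next
  case False
  then show ?thesis using assms
    by (cases "j < s") (auto simp: removed_def cf_act_lead_pos sc_solT solS_def)
qed

lemma ord_solT: "fil s (g + s) U \<Longrightarrow> ord_ge s g (solT s \<alpha> e U)"
  by (auto simp: ord_ge_def fil_def sc_solT gdeg_def wt_def)

lemma fil_solS:
  assumes "fil s (g + s) U"
  shows "fil s g (solS s \<alpha> e U)"
  unfolding fil_def
proof (intro allI impI)
  fix i j and m :: "'a \<Rightarrow> nat" assume g: "gdeg s i j m < g"
  then have "cf U i (j + s) m = 0" using assms by (auto simp: fil_def gdeg_def wt_def)
  moreover have "i = 0 \<Longrightarrow> sc (solT s \<alpha> e U) j m = 0"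
    using ord_solT[OF assms] g by (auto simp: ord_ge_def gdeg_def)
  ultimately show "cf (solS s \<alpha> e U) i j m = 0" by (auto simp: solS_def)
qed

lemma solT_diff: "solT s \<alpha> e (U - U') = solT s \<alpha> e U - solT s \<alpha> e U'"
  by (rule ser_eqI) (simp add: sc_solT diff_divide_distrib)

lemma solS_diff: "solS s \<alpha> e (U - U') = solS s \<alpha> e U - solS s \<alpha> e U'"
  by (rule fld_eqI) (simp add: solS_def solT_diff diff_divide_distrib)


section \<open>The exponential of the adjoint action\<close>

text \<open>
  A generator of grade at least one raises the grade, so the coefficient at a position of grade
  \<open>g\<close> is determined by the first \<open>g + 1\<close> terms of the exponential series.
\<close>

definition expad :: "nat \<Rightarrow> 'r::finite fld \<Rightarrow> 'r fld \<Rightarrow> 'r fld" where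
  "expad s S x = mk_fld (\<lambda>i j m. \<Sum>l\<le>gdeg s i j m. cf ((bk S ^^ l) x) i j m / fact l)"

lemma fil_bk_power:
  assumes "fil s 1 S" "fil s h x"
  shows "fil s (h + l) ((bk S ^^ l) x)"
proof (induct l)
  case (Suc l)
  then show ?case using fil_bk[OF assms(1) Suc] by simp
qed (use assms in simp)

lemma cf_expad:
  assumes "fil s 1 S" "gdeg s i j m \<le> M"
  shows "cf (expad s S x) i j m = (\<Sum>l\<le>M. cf ((bk S ^^ l) x) i j m / fact l)"
  unfolding expad_def cf_mk_fld
proof (rule sum.mono_neutral_left)
  show "\<forall>l\<in>{..M} - {..gdeg s i j m}. cf ((bk S ^^ l) x) i j m / fact l = 0"
    using fil_bk_power[OF assms(1) fil_0] by (auto simp: fil_def)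
qed (use assms in auto)

text \<open>
  Telescoping: in each summand one generator or the argument is replaced by a difference, which
  gains order \<open>g\<close>, and at least \<open>l - 1\<close> generators are left, contributing order one each.
\<close>

lemma fil_bk_power_diff:
  assumes "fil s 1 S" "fil s 1 S'" "fil s h x" "fil s h x'"
    and "fil s g (S - S')" "fil s (g + h) (x - x')"
  shows "fil s (g + h + l - 1) ((bk S ^^ l) x - (bk S' ^^ l) x')"
proof (induct l)
  case 0
  show ?case using fil_mono[OF assms(6), of "g + h + 0 - 1"] by (simp only: funpow_0)
next
  case (Suc l)
  have "fil s (1 + (g + h + l - 1)) (bk S ((bk S ^^ l) x - (bk S' ^^ l) x'))"
    by (rule fil_bk[OF assms(1) Suc])
  moreover have "fil s (g + (h + l)) (bk (S - S') ((bk S' ^^ l) x'))"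
    by (intro fil_bk fil_bk_power assms)
  ultimately have "fil s (g + h + l) (bk S ((bk S ^^ l) x - (bk S' ^^ l) x')
      + bk (S - S') ((bk S' ^^ l) x'))"
    by (intro fil_add) (erule fil_mono, simp)+
  then have "fil s (g + h + l) (bk S ((bk S ^^ l) x) - bk S' ((bk S' ^^ l) x'))"
    by (simp add: bk_diff_left bk_diff_right)
  then show ?case by (simp only: funpow.simps o_apply add_Suc_right diff_Suc_1)
qed

text \<open>
  Changing the generator and the argument in grade \<open>g\<close> changes the result by the linearised
  action; the quadratic and higher terms of the exponential gain another grade.
\<close>

lemma fil_expad_diff:
  assumes S: "fil s 1 S" "fil s 1 S'" and x: "fil s h x" "fil s h x'"
    and d: "fil s g (S - S')" "fil s (g + h) (x - x')"
  shows "fil s (g + h + 1) (expad s S x - expad s S' x' - ((x - x') + (bk S x - bk S' x')))"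
  unfolding fil_def
proof (intro allI impI)
  fix i j and m :: "'a \<Rightarrow> nat" assume gd: "gdeg s i j m < g + h + 1"
  define M where "M = Suc (Suc (g + h))"
  let ?t = "\<lambda>l. cf ((bk S ^^ l) x - (bk S' ^^ l) x') i j m / fact l"
  have "cf (expad s S x - expad s S' x') i j m = (\<Sum>l\<le>M. ?t l)"
    using gd by (simp add: cf_expad[OF S(1), where M = M] cf_expad[OF S(2), where M = M] M_def
        diff_divide_distrib sum_subtractf)
  also have "\<dots> = (\<Sum>l\<in>{0, 1}. ?t l)"
  proof (rule sum.mono_neutral_right)
    show "\<forall>l\<in>{..M} - {0, 1}. ?t l = 0"
    proof
      fix l assume "l \<in> {..M} - {0, 1}"
      then have "g + h + 1 \<le> g + h + l - 1" by auto
      then show "?t l = 0"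
        using fil_bk_power_diff[OF S x d, of l] gd unfolding fil_def by auto
    qed
  qed (auto simp: M_def)
  finally show "cf (expad s S x - expad s S' x' - ((x - x') + (bk S x - bk S' x'))) i j m = 0"
    by simp
qed


lemma fil_expad_self:
  assumes "fil s 1 S" "fil s h x"
  shows "fil s (1 + h) (expad s S x - x)"
  unfolding fil_def
proof (intro allI impI)
  fix i j and m :: "'a \<Rightarrow> nat" assume gd: "gdeg s i j m < 1 + h"
  have "cf (expad s S x) i j m = (\<Sum>l\<le>h. cf ((bk S ^^ l) x) i j m / fact l)"
    using gd by (intro cf_expad assms) simp
  also have "\<dots> = (\<Sum>l\<in>{0}. cf ((bk S ^^ l) x) i j m / fact l)"
    using fil_bk_power[OF assms] gd by (intro sum.mono_neutral_right) (auto simp: fil_def)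
  finally show "cf (expad s S x - x) i j m = 0" by simp
qed


section \<open>Existence of the normalising transformation\<close>

definition removed_part :: "nat \<Rightarrow> 'r::finite fld \<Rightarrow> 'r fld" where
  "removed_part s U = mk_fld (\<lambda>i j m. if removed s i j \<and> s < gdeg s i j m then cf U i j m else 0)"

lemma removed_part_diff: "removed_part s (U - U') = removed_part s U - removed_part s U'"
  by (rule fld_eqI) (simp add: removed_part_def)

lemma removed_part_idem: "removed_part s (removed_part s U) = removed_part s U"
  by (rule fld_eqI) (simp add: removed_part_def)

lemma fil_removed_part: "fil s g U \<Longrightarrow> fil s g (removed_part s U)"
  by (simp add: fil_def removed_part_def)

lemma fil_removed_part_Suc: "fil s (1 + s) (removed_part s U)"
  by (auto simp: fil_def removed_part_def)

text \<open>
  The unknown is a field \<open>U\<close> supported on the removed positions; it determines the transformation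
  by \<open>T = solT U\<close>, \<open>S = solS U\<close>. If \<open>N U\<close> denotes the transformed field, then
  \<open>N U - N U'\<close> agrees with \<open>U - U'\<close> on removed positions up to one higher grade, because
  \<open>solT\<close> and \<open>solS\<close> invert the linearised action. So \<open>U \<mapsto> U - (N U - L)\<close>, with
  \<open>L\<close> the lowest part and everything restricted to removed positions, is a contraction, and at its
  fixed point the removed part of \<open>N U - L\<close> vanishes. Positions of grade at most \<open>s\<close> are
  left alone: they carry the lowest part itself.
\<close>

lemma normalising_transformation_exists:
  fixes v :: "'r::finite fld"
  assumes nz: "\<alpha> \<noteq> 0" "e 1 \<noteq> 0" and v: "fil s (1 + s) (v - lead s \<alpha> e)"
  obtains T S where "ord_ge s 1 T" "fil s 1 S" "\<And>i. 0 < i \<Longrightarrow> fps_nth (S i) 0 = 0"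
    "fil s (1 + s) (expad s S (v + tmul T v) - lead s \<alpha> e)"
    "\<And>i j m. removed s i j \<Longrightarrow> s < gdeg s i j m \<Longrightarrow> cf (expad s S (v + tmul T v)) i j m = 0"
proof -
  define L where "L = (lead s \<alpha> e :: 'r fld)"
  define TT where "TT U = solT s \<alpha> e (removed_part s U)" for U :: "'r fld"
  define SS where "SS U = solS s \<alpha> e (removed_part s U)" for U :: "'r fld"
  define x where "x U = v + tmul (TT U) v" for U
  define N where "N U = expad s (SS U) (x U)" for U
  have T1: "ord_ge s 1 (TT U)" and S1: "fil s 1 (SS U)" for U
    unfolding TT_def SS_def by (rule ord_solT fil_solS, rule fil_removed_part_Suc)+
  have vs: "fil s s v"
  proof -
    have "fil s s ((v - L) + L)"
      unfolding L_def by (intro fil_add fil_lead fil_mono[OF v]) simp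
    then show ?thesis by simp
  qed
  have Tv: "fil s (1 + s) (tmul (TT U) v)" for U by (rule fil_tmul[OF T1 vs])
  have xs: "fil s s (x U)" for U
    unfolding x_def by (rule fil_add[OF vs fil_mono[OF Tv]]) simp
  have xL: "fil s (1 + s) (x U - L)" for U
  proof -
    have "fil s (1 + s) ((v - L) + tmul (TT U) v)"
      using v Tv unfolding L_def by (rule fil_add)
    then show ?thesis by (simp add: x_def algebra_simps)
  qed
  have lin: "fil s (g + s + 1) (N U - N U' - act (TT U - TT U') (SS U - SS U') L)"
    if "fil s (g + s) (removed_part s U - removed_part s U')" for g U U'
  proof -
    have T: "ord_ge s g (TT U - TT U')" and S: "fil s g (SS U - SS U')"
      unfolding TT_def SS_def solT_diff[symmetric] solS_diff[symmetric]
      by (rule ord_solT fil_solS, rule that)+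
    have xx: "x U - x U' = tmul (TT U - TT U') v"
      by (simp add: x_def tmul_diff_left)
    then have fx: "fil s (g + s) (x U - x U')" using fil_tmul[OF T vs] by simp
    have 1: "fil s (g + s + 1) (N U - N U' - ((x U - x U') + (bk (SS U) (x U) - bk (SS U') (x U'))))"
      unfolding N_def by (rule fil_expad_diff[OF S1 S1 xs xs S fx])
    have 2: "fil s (g + s + 1) (tmul (TT U - TT U') (v - L))"
      using fil_tmul[OF T v] by (simp add: L_def add.assoc)
    have 3: "fil s (g + s + 1) (bk (SS U - SS U') (x U - L))"
      using fil_bk[OF S xL] by (simp add: add.assoc)
    have 4: "fil s (g + s + 1) (bk (SS U') (x U - x U'))"
      using fil_bk[OF S1 fx] by (simp add: add.assoc)
    have eq: "N U - N U' - act (TT U - TT U') (SS U - SS U') L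
        = (N U - N U' - ((x U - x U') + (bk (SS U) (x U) - bk (SS U') (x U'))))
          + (tmul (TT U - TT U') (v - L) + bk (SS U - SS U') (x U - L) + bk (SS U') (x U - x U'))"
      by (simp add: act_def bk_diff_left bk_diff_right tmul_diff_right xx[symmetric])
    show ?thesis unfolding eq by (intro fil_add 1 2 3 4)
  qed
  have "\<exists>U. removed_part s U - removed_part s (N U - L) = U"
  proof (rule fil_contraction_fixpoint[of s])
    fix g and U U' :: "'r fld" assume "fil s g (U - U')"
    then have "fil s g (removed_part s U - removed_part s U')"
      by (metis fil_removed_part removed_part_diff)
    moreover have "fil s (1 + s) (removed_part s U - removed_part s U')"
      by (metis fil_removed_part_Suc removed_part_diff)
    ultimately have f: "fil s (max g (1 + s) - s + s) (removed_part s U - removed_part s U')"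
      by (simp add: max_def)
    have sol: "removed_part s (act (TT U - TT U') (SS U - SS U') L) = removed_part s (U - U')"
    proof (rule fld_eqI)
      fix i j m
      show "cf (removed_part s (act (TT U - TT U') (SS U - SS U') L)) i j m
          = cf (removed_part s (U - U')) i j m"
        unfolding TT_def SS_def L_def solT_diff[symmetric] solS_diff[symmetric]
        by (subst (1 2) removed_part_def)
          (simp add: cf_act_sol[of \<alpha> e, OF nz] del: cf_diff, simp add: removed_part_def)
    qed
    have eq: "removed_part s U - removed_part s (N U - L) - (removed_part s U' - removed_part s (N U' - L))
        = removed_part s (act (TT U - TT U') (SS U - SS U') L - (N U - N U'))"
      by (simp only: removed_part_diff [of s "act _ _ _"] sol) (simp add: removed_part_diff)
    show "fil s (g + 1)
        (removed_part s U - removed_part s (N U - L) - (removed_part s U' - removed_part s (N U' - L)))"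
      unfolding eq
    proof (rule fil_removed_part)
      have "fil s (g + 1) (0 - (N U - N U' - act (TT U - TT U') (SS U - SS U') L))"
        by (rule fil_diff[OF fil_zero fil_mono[OF lin[OF f]]]) simp
      then show "fil s (g + 1) (act (TT U - TT U') (SS U - SS U') L - (N U - N U'))" by simp
    qed
  qed
  then obtain U where U: "removed_part s U - removed_part s (N U - L) = U" by blast
  then have "removed_part s U = U" by (metis removed_part_diff removed_part_idem)
  with U have R: "removed_part s (N U - L) = 0" by simp
  have NL: "fil s (1 + s) (N U - L)"
  proof -
    have "fil s (1 + s) ((N U - x U) + (x U - L))"
      unfolding N_def by (intro fil_add fil_expad_self S1 xs xL)
    then show ?thesis by simp
  qed
  show ?thesis
  proof (rule that[of "TT U" "SS U"])
    show "fps_nth (SS U i) 0 = 0" if "0 < i" for i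
      using that by (intro mser_eqI) (simp add: SS_def solS_def mk_fld_def)
    show "fil s (1 + s) (expad s (SS U) (v + tmul (TT U) v) - lead s \<alpha> e)"
      using NL by (simp add: N_def x_def L_def)
    fix i j and m :: "'r \<Rightarrow> nat" assume r: "removed s i j" "s < gdeg s i j m"
    then have "cf (N U - L) i j m = 0"
      using arg_cong[OF R, of "\<lambda>F. cf F i j m"] by (simp add: removed_part_def)
    moreover have "cf L i j m = 0"
      using r by (auto simp: L_def cf_lead gdeg_def wt_def)
    ultimately show "cf (expad s (SS U) (v + tmul (TT U) v)) i j m = 0"
      by (simp add: N_def x_def)
  qed (rule T1 S1)+
qed


section \<open>Initial parts of the tangent space\<close>

text \<open>
  A field commutes with itself, whence \<open>[G W, W] = (W 0 D G) W\<close>, and a time rescaling by \<open>- W 0 D G\<close>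
  cancels this. Constant rotations commute with everything.
\<close>

lemma act_exact_kernel:
  assumes "\<kappa> 0 = 0"
  shows "act (- (W 0 * eul G)) (\<lambda>i. G * W i + fps_const (\<kappa> i)) W = 0"
  using assms by (auto simp: act_def bk_def tmul_def fun_eq_iff eul_mult algebra_simps)

text \<open>
  If \<open>T W + [S, W]\<close> starts later than the orders of \<open>T\<close> and \<open>S\<close> suggest, then the leading part of
  \<open>(T, S)\<close> is killed by the linearised action. The resulting equations force it to be the leading
  part of an exact symmetry from lemma \<open>act_exact_kernel\<close>, with \<open>G\<close> read off from
  the component of \<open>S\<close> along \<open>Ehat\<close> divided by \<open>\<alpha> z^s\<close>; subtracting that symmetry raises the order.
\<close>

lemma raise_order:
  fixes W :: "'r::finite fld"
  assumes nz: "\<alpha> \<noteq> 0" "e 1 \<noteq> 0" and W: "fil s (1 + s) (W - lead s \<alpha> e)"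
    and T: "ord_ge s g T" and S: "fil s g S" and M: "fil s (g + s + 1) (act T S W)"
  obtains T' S' where "ord_ge s (g + 1) T'" "fil s (g + 1) S'" "act T' S' W = act T S W"
proof -
  define L where "L = (lead s \<alpha> e :: 'r fld)"
  have W0: "ord_ge s (1 + s) (W 0 - L 0)"
    using W[unfolded fil_iff_ord, rule_format, of 0] by (simp add: L_def)
  have Wi: "ord_ge s 1 (W i - L i)" if "0 < i" for i
    using W[unfolded fil_iff_ord, rule_format, of i] that by (simp add: L_def)
  define G where "G = (Abs_fps (\<lambda>l. Abs_mser (\<lambda>m. cf S 0 (l + s) m / \<alpha>)) :: 'r mser fps)"
  \<comment> \<open>chosen so that the constant coefficient of each rotational component matches as well; the
      equations say nothing about it\<close>
  define \<kappa> where "\<kappa> i = (if i = 0 then 0 else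
      Abs_mser (\<lambda>m. cf S i 0 m - e i * sc G 0 m) :: 'r mser)" for i
  define T' where "T' = T - (- (W 0 * eul G))"
  define S' where "S' = S - (\<lambda>i. G * W i + fps_const (\<kappa> i))"
  have scG: "sc G l m = cf S 0 (l + s) m / \<alpha>" for l m by (simp add: G_def)
  have G: "ord_ge s (g - s) G"
    using S by (auto simp: ord_ge_def fil_def scG gdeg_def wt_def)
  have D: "fil s (g + s + 1) (act T S L)"
  proof -
    have "fil s (g + s + 1) (act T S (W - L))"
      using fil_act[OF T S W] by (simp add: L_def add.assoc)
    then have "fil s (g + s + 1) (act T S W - act T S (W - L))" by (rule fil_diff[OF M])
    then show ?thesis by (simp add: act_diff_right)
  qed
  \<comment> \<open>the resulting linear equations for the coefficients of grade at most \<open>g\<close>\<close>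
  have eq0: "sc T j m + (2 * real j - 2 * real s) * cf S 0 j m = 0" if "wt s j m < g + 1" for j m
  proof -
    have "cf (act T S L) 0 (j + s) m = 0"
      using D that by (auto simp: fil_def gdeg_def wt_def)
    then show ?thesis using nz unfolding L_def cf_act_lead_0 by simp
  qed
  have eqi: "e i * sc T j m + (if j < s then 0 else 2 * \<alpha> * real (j - s) * cf S i (j - s) m) = 0"
    if "0 < i" "wt s j m < g + 1" for i j m
  proof -
    have "cf (act T S L) i j m = 0"
      using D that by (auto simp: fil_def gdeg_def)
    then show ?thesis unfolding L_def cf_act_lead_pos[OF that(1)] .
  qed
  have Tlow: "sc T j m = 0" if "wt s j m < g + 1" "j < s" for j m
    using eqi[of 1 j m] that nz by simp
  have Slow: "cf S 0 j m = 0" if "wt s j m < g + 1" "j < s" for j m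
    using eq0[OF that(1)] Tlow[OF that] that(2) by simp
  have L0: "L 0 = fps_const (mconst \<alpha>) * fps_X ^ s"
    and Li: "0 < i \<Longrightarrow> L i = fps_const (mconst (e i))" for i
    by (auto simp: L_def lead_def)
  show ?thesis
  proof
    show "act T' S' W = act T S W"
      unfolding T'_def S'_def act_diff_left
      by (subst act_exact_kernel) (simp_all add: \<kappa>_def)
    have "T' = (T + fps_const (mconst \<alpha>) * (fps_X ^ s * eul G)) + (W 0 - L 0) * eul G"
      by (simp add: T'_def L0 algebra_simps)
    moreover have "ord_ge s (g + 1) ((W 0 - L 0) * eul G)"
      by (rule ord_ge_mono[OF ord_ge_mult[OF W0 ord_ge_eul[OF G]]]) auto
    moreover have "ord_ge s (g + 1) (T + fps_const (mconst \<alpha>) * (fps_X ^ s * eul G))"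
      unfolding ord_ge_def
    proof (intro allI impI)
      fix j and m :: "'r \<Rightarrow> nat" assume "wt s j m < g + 1"
      then show "sc (T + fps_const (mconst \<alpha>) * (fps_X ^ s * eul G)) j m = 0"
        using eq0[of j m] Tlow[of j m] nz
        by (simp only: sc_add sc_const_mult sc_X_power_mult sc_eul scG)
          (auto simp: of_nat_diff algebra_simps)
    qed
    ultimately show "ord_ge s (g + 1) T'" by (simp only: ord_ge_add)
    show "fil s (g + 1) S'"
      unfolding fil_iff_ord
    proof
      fix i
      show "ord_ge s (if i = 0 then g + 1 else g + 1 - s) (S' i)"
      proof (cases "i = 0")
        case True
        have "S' 0 = (S 0 - fps_const (mconst \<alpha>) * (fps_X ^ s * G)) - (W 0 - L 0) * G"
          by (simp add: S'_def \<kappa>_def L0 algebra_simps)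
        moreover have "ord_ge s (g + 1) ((W 0 - L 0) * G)"
          by (rule ord_ge_mono[OF ord_ge_mult[OF W0 G]]) auto
        moreover have "ord_ge s (g + 1) (S 0 - fps_const (mconst \<alpha>) * (fps_X ^ s * G))"
          using Slow nz by (auto simp: ord_ge_def sc_X_power_mult scG cf_def)
        ultimately show ?thesis using True by (simp add: ord_ge_diff)
      next
        case False
        then have i: "0 < i" by simp
        have "S' i = (S i - fps_const (mconst (e i)) * G - fps_const (\<kappa> i)) - (W i - L i) * G"
          using i by (simp add: S'_def Li algebra_simps)
        moreover have "ord_ge s (g + 1 - s) ((W i - L i) * G)"
          by (rule ord_ge_mono[OF ord_ge_mult[OF Wi[OF i] G]]) auto
        moreover have "ord_ge s (g + 1 - s) (S i - fps_const (mconst (e i)) * G - fps_const (\<kappa> i))"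
          unfolding ord_ge_def
        proof (intro allI impI)
          fix j and m :: "'r \<Rightarrow> nat" assume wt: "wt s j m < g + 1 - s"
          show "sc (S i - fps_const (mconst (e i)) * G - fps_const (\<kappa> i)) j m = 0"
          proof (cases "j = 0")
            case True
            then show ?thesis using i
              by (simp only: sc_diff sc_const_mult) (simp add: \<kappa>_def cf_def sc_def)
          next
            case False
            have wt': "wt s (j + s) m < g + 1" using wt by (simp add: wt_def)
            have "e i * sc T (j + s) m + 2 * \<alpha> * real j * cf S i j m = 0"
              using eqi[OF i wt'] by simp
            moreover have "sc T (j + s) m + 2 * real j * cf S 0 (j + s) m = 0"
              using eq0[OF wt'] by (simp add: algebra_simps)
            ultimately have "2 * real j * (\<alpha> * cf S i j m - e i * cf S 0 (j + s) m) = 0"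
              by (algebra)
            then have "\<alpha> * cf S i j m = e i * cf S 0 (j + s) m" using False by simp
            then show ?thesis using False nz
              by (simp only: sc_diff sc_const_mult scG) (simp add: cf_def sc_def field_simps)
          qed
        qed
        ultimately show ?thesis using False by (simp add: ord_ge_diff)
      qed
    qed
  qed
qed

lemma raise_order_iter:
  fixes W :: "'r::finite fld"
  assumes nz: "\<alpha> \<noteq> 0" "e 1 \<noteq> 0" and W: "fil s (1 + s) (W - lead s \<alpha> e)"
    and T: "ord_ge s 1 T" and S: "fil s 1 S" and M: "fil s i (act T S W)"
    and g: "1 \<le> g" "g + s \<le> i"
  shows "\<exists>T' S'. ord_ge s g T' \<and> fil s g S' \<and> act T' S' W = act T S W"
  using g
proof (induct g)
  case (Suc g)
  show ?case
  proof (cases "g = 0")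
    case False
    with Suc obtain T' S' where 1: "ord_ge s g T'" "fil s g S'" "act T' S' W = act T S W" by auto
    have "fil s (g + s + 1) (act T' S' W)"
      unfolding 1(3) by (rule fil_mono[OF M]) (use Suc in simp)
    from raise_order[of \<alpha> e s W, OF nz W 1(1,2) this] 1(3) show ?thesis by fastforce
  qed (use T S in auto)
qed simp

text \<open>
  After raising the order of \<open>(T, S)\<close> to \<open>g - s\<close>, grade \<open>g\<close> only sees the linearised action. There
  the coefficients outside the removed positions depend only on the coefficients of \<open>T\<close> at \<open>z^j\<close> with
  \<open>j \<le> s\<close>, and those can be read off from the removed positions in the first rotation (\<open>j < s\<close>) and
  from \<open>z^(2 s) Ehat\<close> (\<open>j = s\<close>).
\<close>

lemma initial_part_trivial:
  fixes W :: "'r::finite fld"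
  assumes nz: "\<alpha> \<noteq> 0" "e 1 \<noteq> 0" and W: "fil s (1 + s) (W - lead s \<alpha> e)"
    and T: "ord_ge s 1 T" and S: "fil s 1 S" and M: "fil s g (act T S W)" and g: "s < g"
    and rem: "\<And>i j m. removed s i j \<Longrightarrow> gdeg s i j m = g \<Longrightarrow> cf (act T S W) i j m = 0"
  shows "fil s (g + 1) (act T S W)"
proof -
  obtain h where h: "g = h + s" "1 \<le> h" using g by (metis add.commute less_imp_add_positive One_nat_def Suc_leI)
  obtain T' S' where T': "ord_ge s h T'" "fil s h S'" "act T' S' W = act T S W"
    using raise_order_iter[of \<alpha> e s W, OF nz W T S M, of h] h by auto
  have lead: "cf (act T S W) i j m = cf (act T' S' (lead s \<alpha> e)) i j m"
    if "gdeg s i j m = g" for i j m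
    using fil_act[OF T'(1,2) W] that h
    by (auto simp: fil_def act_diff_right T'(3))
  show ?thesis
    unfolding fil_def
  proof (intro allI impI)
    fix i j and m :: "'r \<Rightarrow> nat" assume "gdeg s i j m < g + 1"
    then consider "gdeg s i j m < g" | "gdeg s i j m = g" by linarith
    then show "cf (act T S W) i j m = 0"
    proof cases
      case 2
      show ?thesis
      proof (cases "removed s i j")
        case nr: False
        show ?thesis
        proof (cases "i = 0")
          case True
          then show ?thesis using nr 2 by (simp add: lead removed_def cf_act_lead_0)
        next
          case False
          have js: "j \<le> s" using nr False by (auto simp: removed_def)
          have "sc T' j m = 0"
          proof (cases "j < s")
            case True
            have gd: "gdeg s 1 j m = g" using 2 False by (simp add: gdeg_def)
            have "cf (act T S W) 1 j m = 0" using gd True by (intro rem) (auto simp: removed_def)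
            then show ?thesis using nz True unfolding lead[OF gd] by (simp add: cf_act_lead_pos)
          next
            case eq: False
            have gd: "gdeg s 0 (s + s) m = g" using 2 False js eq by (simp add: gdeg_def wt_def)
            have "cf (act T S W) 0 (s + s) m = 0" using gd by (intro rem) (auto simp: removed_def)
            then show ?thesis using nz js eq unfolding lead[OF gd] by (simp add: cf_act_lead_0)
          qed
          then show ?thesis using False 2 js by (simp add: lead cf_act_lead_pos)
        qed
      qed (use rem 2 in auto)
    qed (use M in \<open>auto simp: fil_def\<close>)
  qed
qed

definition thomog :: "nat \<Rightarrow> nat \<Rightarrow> 'r::finite mser fps \<Rightarrow> bool" where
  "thomog s g f \<longleftrightarrow> (\<forall>j m. sc f j m \<noteq> 0 \<longrightarrow> wt s j m = g)"

definition homog :: "nat \<Rightarrow> nat \<Rightarrow> 'r::finite fld \<Rightarrow> bool" where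
  "homog s g F \<longleftrightarrow> (\<forall>i j m. cf F i j m \<noteq> 0 \<longrightarrow> gdeg s i j m = g)"

definition gr :: "nat \<Rightarrow> nat \<Rightarrow> 'r::finite fld \<Rightarrow> 'r fld" where
  "gr s g F = mk_fld (\<lambda>i j m. if gdeg s i j m = g then cf F i j m else 0)"

lemma cf_gr: "cf (gr s g F) i j m = (if gdeg s i j m = g then cf F i j m else 0)"
  by (simp add: gr_def)

lemma homog_add: "homog s g F \<Longrightarrow> homog s g G \<Longrightarrow> homog s g (F + G)"
  and homog_diff: "homog s g F \<Longrightarrow> homog s g G \<Longrightarrow> homog s g (F - G)"
  unfolding homog_def cf_add cf_diff by (metis add_0, metis diff_0 neg_equal_0_iff_equal)

lemma homog_gr: "homog s g (gr s g F)"
  by (simp add: homog_def cf_gr)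

lemma ord_ge_thomog: "thomog s g f \<Longrightarrow> h \<le> g \<Longrightarrow> ord_ge s h f"
  and fil_homog: "homog s g F \<Longrightarrow> h \<le> g \<Longrightarrow> fil s h F"
  unfolding ord_ge_def fil_def thomog_def homog_def by (metis leD)+

lemma cf_act_homog_less:
  "thomog s g T \<Longrightarrow> homog s g S \<Longrightarrow> gdeg s i j m < g \<Longrightarrow> cf (act T S W) i j m = 0"
  using fil_act[OF ord_ge_thomog[of s g T g] fil_homog[of s g S g] fil_0, of W] by (simp add: fil_def)

lemma cf_act_homog:
  assumes T: "thomog s g T" and S: "homog s g S" and g: "g + h = gdeg s i j m"
  shows "cf (act T S W) i j m = cf (act T S (gr s h W)) i j m"
proof -
  have "sc (T * W i) j m = sc (T * gr s h W i) j m"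
  proof (rule sc_mult_cong)
    fix j1 j2 and m1 m2 :: "'a \<Rightarrow> nat" assume jm: "j1 + j2 = j" "m1 + m2 = m"
    show "sc T j1 m1 * sc (W i) j2 m2 = sc T j1 m1 * sc (gr s h W i) j2 m2"
    proof (cases "sc T j1 m1 = 0")
      case False
      then have "wt s j1 m1 = g" using T by (simp add: thomog_def)
      then have "gdeg s i j2 m2 = h"
        using g unfolding gdeg_def jm[symmetric] wt_add by simp
      then show ?thesis using cf_gr[of s h W i j2 m2] by (simp add: cf_def)
    qed simp
  qed
  moreover have "sc (W 0 * eul (S i)) j m = sc (gr s h W 0 * eul (S i)) j m"
  proof (rule sc_mult_cong)
    fix j1 j2 and m1 m2 :: "'a \<Rightarrow> nat" assume jm: "j1 + j2 = j" "m1 + m2 = m"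
    show "sc (W 0) j1 m1 * sc (eul (S i)) j2 m2 = sc (gr s h W 0) j1 m1 * sc (eul (S i)) j2 m2"
    proof (cases "sc (S i) j2 m2 = 0")
      case False
      then have "gdeg s i j2 m2 = g" using S by (simp add: homog_def cf_def)
      then have "gdeg s 0 j1 m1 = h"
        using g unfolding gdeg_def jm[symmetric] wt_add by simp
      then show ?thesis using cf_gr[of s h W 0 j1 m1] by (simp add: cf_def)
    qed simp
  qed
  moreover have "sc (S 0 * eul (W i)) j m = sc (S 0 * eul (gr s h W i)) j m"
  proof (rule sc_mult_cong)
    fix j1 j2 and m1 m2 :: "'a \<Rightarrow> nat" assume jm: "j1 + j2 = j" "m1 + m2 = m"
    show "sc (S 0) j1 m1 * sc (eul (W i)) j2 m2 = sc (S 0) j1 m1 * sc (eul (gr s h W i)) j2 m2"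
    proof (cases "sc (S 0) j1 m1 = 0")
      case False
      then have "gdeg s 0 j1 m1 = g" using S by (simp add: homog_def cf_def)
      then have "gdeg s i j2 m2 = h"
        using g unfolding gdeg_def jm[symmetric] wt_add by simp
      then show ?thesis using cf_gr[of s h W i j2 m2] by (simp add: cf_def)
    qed simp
  qed
  ultimately show ?thesis by (simp add: cf_def act_def tmul_def bk_def)
qed

lemma act_zero_right [simp]: "act T S 0 = 0"
  and act_zero_left [simp]: "act 0 0 W = 0"
  by (auto simp: act_def tmul_def bk_def fun_eq_iff)

lemma act_sum: "act (\<Sum>x\<in>A. T x) (\<Sum>x\<in>A. S x) W = (\<Sum>x\<in>A. act (T x) (S x) W)"
  by (induct A rule: infinite_finite_induct)
    (simp_all only: not_False_eq_True simp_thms sum.infinite sum.empty sum.insert act_zero_left act_add_left)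

lemma homog_act:
  assumes T: "thomog s g T" and S: "homog s g S" and V: "homog s h V"
  shows "homog s (g + h) (act T S V)"
  unfolding homog_def
proof (intro allI impI)
  fix i j and m :: "'a \<Rightarrow> nat" assume nz: "cf (act T S V) i j m \<noteq> 0"
  then have "g \<le> gdeg s i j m" using cf_act_homog_less[OF T S] by (meson leI)
  then obtain h' where h': "gdeg s i j m = g + h'" by (auto dest: le_Suc_ex)
  have "h' = h"
  proof (rule ccontr)
    assume ne: "h' \<noteq> h"
    then have "gr s h' V = 0"
      using V by (intro fld_eqI) (auto simp: cf_gr homog_def)
    then show False using nz cf_act_homog[OF T S h'[symmetric], of V] by simp
  qed
  then show "gdeg s i j m = g + h" using h' by simp
qed

lemma cf_sum: "cf (\<Sum>x\<in>A. F x) i j m = (\<Sum>x\<in>A. cf (F x) i j m)"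
  by (induct A rule: infinite_finite_induct)
    (simp_all only: not_False_eq_True simp_thms sum.infinite sum.empty sum.insert cf_0 cf_add)

lemma homog_sum:
  assumes "\<And>x. x \<in> A \<Longrightarrow> homog s g (F x)"
  shows "homog s g (\<Sum>x\<in>A. F x)"
  unfolding homog_def cf_sum
proof (intro allI impI)
  fix i j m assume "(\<Sum>x\<in>A. cf (F x) i j m) \<noteq> 0"
  then obtain x where "x \<in> A" "cf (F x) i j m \<noteq> 0" by (rule sum.not_neutral_contains_not_neutral)
  then show "gdeg s i j m = g" using assms[of x] by (simp add: homog_def)
qed

text \<open>The maps \<open>d^(i,r)\<close> in terms of sequences of series.\<close>

definition dm :: "(nat \<Rightarrow> 'r::finite fld) \<Rightarrow> nat \<Rightarrow> nat \<Rightarrow> (nat \<Rightarrow> 'r mser fps) \<Rightarrow> (nat \<Rightarrow> 'r fld) \<Rightarrow> 'r fld"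
  where "dm V i r T S = (\<Sum>j<r. act (T (i - j)) (S (i - j)) (V j))"

lemma homog_dm:
  assumes "\<And>g. 1 \<le> g \<Longrightarrow> g \<le> i \<Longrightarrow> thomog s g (T g) \<and> homog s g (S g)" and "\<And>j. homog s j (V j)"
  shows "homog s i (dm V i i T S)"
  unfolding dm_def
proof (rule homog_sum)
  fix j assume "j \<in> {..<i}"
  then have j: "1 \<le> i - j" "i - j \<le> i" "i - j + j = i" by auto
  show "homog s i (act (T (i - j)) (S (i - j)) (V j))"
    using homog_act[of s "i - j" "T (i - j)" "S (i - j)" j "V j"] assms(1)[OF j(1,2)] assms(2) j(3)
    by simp
qed

text \<open>
  The condition that a tuple lies in the domain of \<open>d^(i,i)\<close> concerns the convolution sums of its
  entries with the parts of \<open>W\<close>. Once the entries are collected into one pair \<open>(T, S)\<close>, these sums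
  are the homogeneous parts of \<open>T W + [S, W]\<close>.
\<close>

lemma cf_act_total:
  assumes TS: "\<And>g. 1 \<le> g \<Longrightarrow> g \<le> i \<Longrightarrow> thomog s g (T g) \<and> homog s g (S g)"
    and h: "gdeg s p j m = h" "h \<le> i"
  shows "cf (act (\<Sum>g=1..i. T g) (\<Sum>g=1..i. S g) W) p j m
       = cf (dm (\<lambda>h. gr s h W) h h T S) p j m"
proof -
  have "cf (act (\<Sum>g=1..i. T g) (\<Sum>g=1..i. S g) W) p j m
      = (\<Sum>g=1..i. cf (act (T g) (S g) W) p j m)"
    by (simp add: act_sum cf_sum)
  also have "\<dots> = (\<Sum>g=1..h. cf (act (T g) (S g) W) p j m)"
  proof (rule sum.mono_neutral_right)
    show "\<forall>g\<in>{1..i} - {1..h}. cf (act (T g) (S g) W) p j m = 0"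
    proof
      fix g assume "g \<in> {1..i} - {1..h}"
      then have "1 \<le> g" "g \<le> i" "h < g" by auto
      then show "cf (act (T g) (S g) W) p j m = 0"
        using TS[of g] h cf_act_homog_less[of s g "T g" "S g"] by simp
    qed
  qed (use h in auto)
  also have "\<dots> = (\<Sum>g=1..h. cf (act (T g) (S g) (gr s (h - g) W)) p j m)"
  proof (rule sum.cong[OF refl])
    fix g assume "g \<in> {1..h}"
    then have "1 \<le> g" "g \<le> i" "g + (h - g) = gdeg s p j m" using h by auto
    then show "cf (act (T g) (S g) W) p j m = cf (act (T g) (S g) (gr s (h - g) W)) p j m"
      using TS[of g] cf_act_homog[of s g "T g" "S g"] by blast
  qed
  also have "\<dots> = (\<Sum>l<h. cf (act (T (h - l)) (S (h - l)) (gr s l W)) p j m)"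
    by (rule sum.reindex_bij_witness[of _ "\<lambda>l. h - l" "\<lambda>g. h - g"]) auto
  finally show ?thesis by (simp add: dm_def cf_sum)
qed

lemma dm_meets_complement_trivially:
  fixes W :: "'r::finite fld"
  assumes nz: "\<alpha> \<noteq> 0" "e 1 \<noteq> 0" and W: "fil s (1 + s) (W - lead s \<alpha> e)"
    and TS: "\<And>g. 1 \<le> g \<Longrightarrow> g \<le> i \<Longrightarrow> thomog s g (T g) \<and> homog s g (S g)"
    and ker: "\<And>h. h < i \<Longrightarrow> dm (\<lambda>h. gr s h W) h h T S = 0"
    and i: "s < i"
    and rem: "\<And>p j m. removed s p j \<Longrightarrow> cf (dm (\<lambda>h. gr s h W) i i T S) p j m = 0"
  shows "dm (\<lambda>h. gr s h W) i i T S = 0"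
proof -
  define TT where "TT = (\<Sum>g=1..i. T g)"
  define SS where "SS = (\<Sum>g=1..i. S g)"
  have tot: "cf (act TT SS W) p j m = cf (dm (\<lambda>h. gr s h W) h h T S) p j m"
    if "gdeg s p j m = h" "h \<le> i" for p j m h
    unfolding TT_def SS_def using that by (intro cf_act_total TS)
  have "ord_ge s 1 TT"
  proof -
    have "ord_ge s 1 (\<Sum>g\<in>A. T g)" if "A \<subseteq> {1..i}" for A
      using that
    proof (induct A rule: infinite_finite_induct)
      case (insert g A)
      then have "ord_ge s 1 (T g)" using TS[of g] ord_ge_thomog[of s g "T g" 1] by simp
      then show ?case using insert by (simp add: ord_ge_add)
    qed (auto simp: ord_ge_def)
    then show ?thesis unfolding TT_def by blast
  qed
  moreover have "fil s 1 SS"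
    unfolding SS_def using TS by (intro fil_sum) (auto intro: fil_homog[of s])
  moreover have "fil s i (act TT SS W)"
    using tot ker by (simp add: fil_def)
  ultimately have "fil s (i + 1) (act TT SS W)"
    using tot rem by (intro initial_part_trivial[of \<alpha> e s W, OF nz W _ _ _ i]) auto
  then have "cf (dm (\<lambda>h. gr s h W) i i T S) p j m = 0" if "gdeg s p j m = i" for p j m
    using tot[OF that] that by (simp add: fil_def)
  moreover have "homog s i (dm (\<lambda>h. gr s h W) i i T S)"
    by (rule homog_dm[OF TS homog_gr])
  ultimately show ?thesis
    by (intro fld_eqI) (metis cf_0 homog_def)
qed


lemma gr_eq_lead:
  assumes "fil s (1 + s) (W - lead s \<alpha> e)"
  shows "h < s \<Longrightarrow> gr s h W = 0" "gr s s W = lead s \<alpha> e"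
proof -
  have W: "cf W i j m = cf (lead s \<alpha> e) i j m" if "gdeg s i j m \<le> s" for i j m
    using assms that by (simp add: fil_def)
  have L: "gdeg s i j m = s" if "cf (lead s \<alpha> e) i j m \<noteq> 0" for i j and m :: "'a \<Rightarrow> nat"
    using that by (auto simp: cf_lead gdeg_def wt_def split: if_splits)
  show "gr s h W = 0" if "h < s"
  proof (rule fld_eqI)
    fix i j m
    show "cf (gr s h W) i j m = cf 0 i j m"
      using W[of i j m] L[of i j m] that
      by (cases "gdeg s i j m = h"; cases "cf (lead s \<alpha> e) i j m = 0") (simp_all add: cf_gr)
  qed
  show "gr s s W = lead s \<alpha> e"
  proof (rule fld_eqI)
    fix i j m
    show "cf (gr s s W) i j m = cf (lead s \<alpha> e) i j m"
      using W[of i j m] L[of i j m]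
      by (cases "gdeg s i j m = s"; cases "cf (lead s \<alpha> e) i j m = 0") (simp_all add: cf_gr)
  qed
qed

lemma thomog_solT:
  assumes "homog s (g + s) U"
  shows "thomog s g (solT s \<alpha> e U)"
  unfolding thomog_def
proof (intro allI impI)
  fix j and m :: "'a \<Rightarrow> nat" assume nz: "sc (solT s \<alpha> e U) j m \<noteq> 0"
  then consider "j < s" "cf U 1 j m \<noteq> 0" | "j = s" "cf U 0 (2 * s) m \<noteq> 0"
    by (auto simp: sc_solT split: if_splits)
  then show "wt s j m = g"
  proof cases
    case 1
    then have "gdeg s 1 j m = g + s" using assms by (metis homog_def)
    then show ?thesis by (simp add: gdeg_def)
  next
    case 2
    then have "gdeg s 0 (2 * s) m = g + s" using assms by (metis homog_def)
    then show ?thesis using 2 by (simp add: gdeg_def wt_def)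
  qed
qed

lemma homog_solS:
  assumes "homog s (g + s) U"
  shows "homog s g (solS s \<alpha> e U)"
  unfolding homog_def
proof (intro allI impI)
  fix i j and m :: "'a \<Rightarrow> nat" assume nz: "cf (solS s \<alpha> e U) i j m \<noteq> 0"
  then have "cf U i (j + s) m \<noteq> 0 \<or> i = 0 \<and> sc (solT s \<alpha> e U) j m \<noteq> 0"
    by (auto simp: solS_def split: if_splits)
  then have "gdeg s i (j + s) m = g + s \<or> i = 0 \<and> wt s j m = g"
    using assms thomog_solT[OF assms] by (auto simp: homog_def thomog_def)
  then show "gdeg s i j m = g" by (auto simp: gdeg_def wt_def)
qed

text \<open>
  A tuple with a single nonzero entry, in grade \<open>i - s\<close>, meets the lowest part of \<open>W\<close> only in grade
  \<open>i\<close>. So the right inverse of the linearised action already reaches all removed positions.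
\<close>

lemma dm_complement_spans:
  fixes W F :: "'r::finite fld"
  assumes nz: "\<alpha> \<noteq> 0" "e 1 \<noteq> 0" and W: "fil s (1 + s) (W - lead s \<alpha> e)"
    and F: "homog s i F" and i: "s < i"
  shows "\<exists>T S. (\<forall>g. thomog s g (T g) \<and> homog s g (S g)) \<and>
    (\<forall>h<i. dm (\<lambda>h. gr s h W) h h T S = 0) \<and>
    (\<forall>p j m. removed s p j \<longrightarrow> cf (F - dm (\<lambda>h. gr s h W) i i T S) p j m = 0)"
proof -
  define T where "T g = (if g = i - s then solT s \<alpha> e F else 0)" for g
  define S where "S g = (if g = i - s then solS s \<alpha> e F else 0)" for g
  have F': "homog s (i - s + s) F" using F i by simp
  have hom: "thomog s g (T g) \<and> homog s g (S g)" for g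
    using thomog_solT[OF F'] homog_solS[OF F']
    by (auto simp: T_def S_def thomog_def homog_def)
  have summand: "act (T g) (S g) (gr s j W) =
      (if g = i - s then act (solT s \<alpha> e F) (solS s \<alpha> e F) (gr s j W) else 0)" for g j
    by (simp add: T_def S_def)
  have low: "dm (\<lambda>h. gr s h W) h h T S = 0" if "h < i" for h
    unfolding dm_def
  proof (rule sum.neutral, rule ballI)
    fix j assume "j \<in> {..<h}"
    then show "act (T (h - j)) (S (h - j)) (gr s j W) = 0"
      using that i unfolding summand by (cases "j < s") (auto simp: gr_eq_lead(1)[OF W])
  qed
  have "dm (\<lambda>h. gr s h W) i i T S = (\<Sum>j\<in>{s}. act (T (i - j)) (S (i - j)) (gr s j W))"
    unfolding dm_def using i by (intro sum.mono_neutral_right) (auto simp: summand)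
  also have "\<dots> = act (solT s \<alpha> e F) (solS s \<alpha> e F) (lead s \<alpha> e)"
    by (simp add: gr_eq_lead(2)[OF W] T_def S_def)
  finally have top: "dm (\<lambda>h. gr s h W) i i T S = act (solT s \<alpha> e F) (solS s \<alpha> e F) (lead s \<alpha> e)" .
  show ?thesis
    using hom low
    by (intro exI[of _ T] exI[of _ S]) (simp add: top cf_act_sol[of \<alpha> e s, OF nz])
qed


section \<open>Leaf vector fields as sequences of series\<close>

lemma fps_nth_Abs: "fps_nth (Abs_fps f) = f"
  by (rule ext) simp

definition ev :: "'r::finite mser fps \<Rightarrow> 'r lfun" where
  "ev f = even_ser (fps_nth f)"

lemma ev_nth: "fps_nth (ev f) d = (if even d then fps_nth f (d div 2) else 0)"
  by (simp add: ev_def even_ser_def)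

lemma ev_add: "ev (f + g) = ev f + ev g"
  and ev_diff: "ev (f - g) = ev f - ev g"
  and ev_0 [simp]: "ev 0 = 0"
  by (auto intro!: fps_ext simp: ev_nth)

lemma ev_const: "ev (fps_const x) = fps_const x"
  by (rule fps_ext) (auto simp: ev_nth elim: evenE)

lemma ev_mult: "ev (f * g) = ev f * ev g"
proof (rule fps_ext)
  fix d
  show "fps_nth (ev (f * g)) d = fps_nth (ev f * ev g) d"
  proof (cases "even d")
    case True
    then obtain l where d: "d = 2 * l" by (elim evenE)
    have "(\<Sum>i=0..l. fps_nth f i * fps_nth g (l - i))
        = (\<Sum>i=0..d. fps_nth (ev f) i * fps_nth (ev g) (d - i))"
      by (rule sum.reindex_bij_witness_not_neutral[of "{}" "{i. i \<le> d \<and> odd i}"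
            _ "\<lambda>i. i div 2" "\<lambda>i. 2 * i"])
        (auto simp: d ev_nth diff_mult_distrib2[symmetric])
    then show ?thesis using d by (simp add: ev_nth fps_mult_nth)
  next
    case False
    then have "fps_nth (ev f) i * fps_nth (ev g) (d - i) = 0" if "i \<le> d" for i
      using that by (auto simp: ev_nth)
    then show ?thesis using False by (simp add: ev_nth fps_mult_nth)
  qed
qed

lemma ev_eul: "fps_X * fps_deriv (ev f) = ev (eul f)"
proof (rule fps_ext)
  fix d
  have eul: "fps_nth (eul f) j = of_nat (2 * j) * fps_nth f j" for j
  proof (rule mser_eqI)
    fix m
    show "mcoeff (fps_nth (eul f) j) m = mcoeff (of_nat (2 * j) * fps_nth f j) m"
      unfolding mcoeff_of_nat_mult using sc_eul[of f j m] by (simp add: sc_def)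
  qed
  have "fps_nth (fps_X * fps_deriv (ev f)) d = of_nat d * fps_nth (ev f) d"
    by (cases d) auto
  then show "fps_nth (fps_X * fps_deriv (ev f)) d = fps_nth (ev (eul f)) d"
    by (auto simp: ev_nth eul elim!: evenE simp del: of_nat_mult)
qed

lemma ev_inj: "ev f = ev g \<Longrightarrow> f = g"
  by (rule fps_ext) (metis ev_nth dvd_triv_left nonzero_mult_div_cancel_left zero_neq_numeral)

lemma mcoeff_rconst_mult: "mcoeff (fps_nth (rconst r * f) d) m = r * mcoeff (fps_nth f d) m"
  by (simp add: rconst_def)

definition lf :: "nat \<Rightarrow> (nat \<Rightarrow> nat) \<Rightarrow> (nat \<Rightarrow> real) \<Rightarrow> 'r::finite fld \<Rightarrow> 'r vfield" where
  "lf k \<sigma> c F = leaf_field k \<sigma> c (fps_nth (F 0)) (\<lambda>i. fps_nth (F i))"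

text \<open>
  A leaf field does not determine the components of its sequence beyond \<open>k\<close>; setting
  them to zero makes the sequence unique.
\<close>

definition trim :: "nat \<Rightarrow> 'r::finite fld \<Rightarrow> 'r fld" where
  "trim k F = (\<lambda>i. if i \<le> k then F i else 0)"

lemma lf_trim: "lf k \<sigma> c (trim k F) = lf k \<sigma> c F"
  by (simp add: lf_def trim_def leaf_field_def)

lemma cf_trim: "cf (trim k F) i j m = (if i \<le> k then cf F i j m else 0)"
  by (simp add: cf_def trim_def)

lemma leaf_field_eq_lf:
  "leaf_field k \<sigma> c a b = lf k \<sigma> c (\<lambda>i. if i = 0 then Abs_fps a else Abs_fps (b i))"
  by (simp add: lf_def leaf_field_def fps_nth_Abs)

lemma leaf_grade_iff:
  "v \<in> leaf_grade k \<sigma> c s g \<longleftrightarrow> (\<exists>F. v = lf k \<sigma> c F \<and> homog s g F \<and> (\<forall>i>k. F i = 0))"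
proof
  assume "v \<in> leaf_grade k \<sigma> c s g"
  then obtain a b where v: "v = leaf_field k \<sigma> c a b"
    and a: "\<And>j m. mcoeff (a j) m \<noteq> 0 \<Longrightarrow> mdeg m * (s + 1) + j = g"
    and b: "\<And>i j m. i \<in> {1..k} \<Longrightarrow> mcoeff (b i j) m \<noteq> 0 \<Longrightarrow> mdeg m * (s + 1) + s + j = g"
    unfolding leaf_grade_def by blast
  let ?F = "trim k (\<lambda>i. if i = 0 then Abs_fps a else Abs_fps (b i))"
  have "wt s j m = g" if "mcoeff (a j) m \<noteq> 0" for j m
    using a[OF that] by (simp add: wt_def)
  moreover have "wt s j m + s = g" if "i \<in> {1..k}" "mcoeff (b i j) m \<noteq> 0" for i j m
    using b[OF that] by (simp add: wt_def)
  ultimately have "homog s g ?F"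
    unfolding homog_def cf_trim
    by (auto simp: cf_def sc_def gdeg_def Suc_le_eq split: if_splits)
  then show "\<exists>F. v = lf k \<sigma> c F \<and> homog s g F \<and> (\<forall>i>k. F i = 0)"
    by (intro exI[of _ ?F]) (auto simp: v leaf_field_eq_lf lf_trim, simp add: trim_def)
next
  assume "\<exists>F. v = lf k \<sigma> c F \<and> homog s g F \<and> (\<forall>i>k. F i = 0)"
  then obtain F where F: "v = lf k \<sigma> c F" "homog s g F" by blast
  have "mdeg m * (s + 1) + j = g" if "mcoeff (fps_nth (F 0) j) m \<noteq> 0" for j m
    using F(2)[unfolded homog_def, rule_format, of 0 j m] that
    by (simp add: cf_def sc_def gdeg_def wt_def)
  moreover have "mdeg m * (s + 1) + s + j = g"
    if "i \<in> {1..k}" "mcoeff (fps_nth (F i) j) m \<noteq> 0" for i j m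
    using F(2)[unfolded homog_def, rule_format, of i j m] that
    by (simp add: cf_def sc_def gdeg_def wt_def)
  ultimately show "v \<in> leaf_grade k \<sigma> c s g"
    unfolding leaf_grade_def F(1) lf_def by blast
qed

lemma lf_in_leaf_grade: "homog s g F \<Longrightarrow> lf k \<sigma> c F \<in> leaf_grade k \<sigma> c s g"
  unfolding leaf_grade_iff
  by (rule exI[of _ "trim k F"]) (auto simp: lf_trim homog_def cf_trim, simp add: trim_def)

lemma time_grade_iff: "f \<in> time_grade s g \<longleftrightarrow> (\<exists>t. f = ev t \<and> thomog s g t)"
proof
  assume "f \<in> time_grade s g"
  then obtain t where "f = even_ser t" "\<And>j m. mcoeff (t j) m \<noteq> 0 \<Longrightarrow> mdeg m * (s + 1) + j = g"
    unfolding time_grade_def by blast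
  then show "\<exists>t. f = ev t \<and> thomog s g t"
    by (intro exI[of _ "Abs_fps t"]) (auto simp: ev_def thomog_def sc_def wt_def fps_nth_Abs)
next
  assume "\<exists>t. f = ev t \<and> thomog s g t"
  then show "f \<in> time_grade s g"
    unfolding time_grade_def ev_def thomog_def sc_def wt_def by blast
qed

locale leaf_frame =
  fixes n k :: nat and \<sigma> :: "nat \<Rightarrow> nat" and c :: "nat \<Rightarrow> real"
  assumes perm: "\<sigma> permutes {1..n}" and k: "1 \<le> k" "k \<le> n"
    and c_pos: "i \<in> {1..k} \<Longrightarrow> 0 < c (\<sigma> i)"
begin

abbreviation LF :: "'r::finite fld \<Rightarrow> 'r vfield" where
  "LF \<equiv> lf k \<sigma> c"

lemma sigma_eq_iff [simp]: "\<sigma> i = \<sigma> j \<longleftrightarrow> i = j"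
  using permutes_inj[OF perm] by (auto dest: injD)

lemma sigma_in: "i \<in> {1..n} \<Longrightarrow> \<sigma> i \<in> {1..n}"
  using permutes_in_image[OF perm] by blast

lemma lf_Rho:
  "l \<in> {1..k} \<Longrightarrow> LF F (Rho (\<sigma> l)) = rconst (c (\<sigma> l) / c (\<sigma> k)) * fps_X * ev (F 0)"
  by (simp add: lf_def leaf_field_def smul_def sum_vfield_apply d_theta_def ev_def
      Ehat_Rho[OF perm] mult_ac)

lemma lf_Theta: "l \<in> {1..k} \<Longrightarrow> LF F (Theta (\<sigma> l)) = ev (F l)"
  by (simp add: lf_def leaf_field_def smul_def sum_vfield_apply d_theta_def ev_def Ehat_Theta
      if_distrib sum.delta cong: if_cong)

definition off_leaf :: "coord \<Rightarrow> bool" where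
  "off_leaf q \<longleftrightarrow> (\<forall>l\<in>{1..k}. q \<noteq> Rho (\<sigma> l) \<and> q \<noteq> Theta (\<sigma> l))"

lemma lf_off_leaf: "off_leaf q \<Longrightarrow> LF F q = 0"
  by (auto simp: off_leaf_def lf_def leaf_field_def smul_def sum_vfield_apply d_theta_def Ehat_def d_rho_def
      intro!: sum.neutral)

lemma coord_cases:
  obtains l where "l \<in> {1..k}" "q = Rho (\<sigma> l)" | l where "l \<in> {1..k}" "q = Theta (\<sigma> l)"
  | "off_leaf q"
  unfolding off_leaf_def by metis

lemma lf_Rho_k: "LF F (Rho (\<sigma> k)) = fps_X * ev (F 0)"
  using lf_Rho[of k F] k c_pos[of k] by (simp add: rconst_1)

lemma lf_add: "LF (F + G) = LF F + LF G"
  by (rule ext, rule_tac q = x in coord_cases)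
    (simp_all add: lf_Rho lf_Theta lf_off_leaf ev_add distrib_left)

lemma lf_diff: "LF (F - G) = LF F - LF G"
  using lf_add[of "F - G" G] by (simp add: algebra_simps)

lemma lf_0 [simp]: "LF 0 = 0"
  using lf_diff[of 0 0] by simp

lemma lf_sum: "LF (\<Sum>x\<in>A. F x) = (\<Sum>x\<in>A. LF (F x))"
  by (induct A rule: infinite_finite_induct)
    (simp_all only: not_False_eq_True simp_thms sum.infinite sum.empty sum.insert lf_0 lf_add)

lemma lf_tmul: "smul (ev f) (LF F) = LF (tmul f F)"
  by (rule ext, rule_tac q = x in coord_cases)
    (simp_all add: smul_def lf_Rho lf_Theta lf_off_leaf tmul_def ev_mult mult_ac)

lemma lf_bk: "brk n k \<sigma> (LF Y) (LF W) = LF (bk Y W)"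
proof
  fix q
  have "\<sigma> k \<in> {1..n}" using k by (intro sigma_in) simp
  note D = Dapp_eq[where \<sigma> = \<sigma> and k = k, OF this]
  have brk: "brk n k \<sigma> (LF Y) (LF W) q
      = fps_deriv (LF Y q) * fps_X * ev (W 0) - fps_deriv (LF W q) * fps_X * ev (Y 0)"
    by (simp add: brk_def D lf_Rho_k mult_ac)
  show "brk n k \<sigma> (LF Y) (LF W) q = LF (bk Y W) q"
  proof (cases q rule: coord_cases)
    case (1 l)
    let ?r = "rconst (c (\<sigma> l) / c (\<sigma> k)) :: 'a lfun"
    have "fps_deriv ?r = 0" by (simp add: rconst_def)
    then have "fps_deriv (LF F q) * fps_X = ?r * fps_X * (ev (F 0) + fps_X * fps_deriv (ev (F 0)))"
      for F :: "'a fld"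
      using 1 by (simp add: lf_Rho algebra_simps)
    then show ?thesis
      unfolding brk ev_eul using 1
      by (simp add: lf_Rho bk_def ev_diff ev_mult algebra_simps)
  next
    case (2 l)
    have "fps_deriv (LF F q) * fps_X = ev (eul (F l))" for F :: "'a fld"
      using 2 by (simp add: lf_Theta ev_eul[symmetric] mult.commute)
    then show ?thesis
      unfolding brk using 2 by (simp add: lf_Theta bk_def ev_diff ev_mult algebra_simps)
  qed (simp add: brk lf_off_leaf)
qed

lemma lf_bk_power: "(brk n k \<sigma> (LF S) ^^ l) (LF x) = LF ((bk S ^^ l) x)"
  by (induct l) (simp_all add: lf_bk)

lemma lf_act: "smul (ev T) (LF W) + brk n k \<sigma> (LF S) (LF W) = LF (act T S W)"
  by (simp add: lf_tmul lf_bk act_def lf_add)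

lemma lf_inj:
  assumes "LF F = LF G" "i \<le> k"
  shows "F i = G i"
proof (cases "i = 0")
  case True
  have "fps_X * ev (F 0) = fps_X * ev (G 0)"
    using assms(1) lf_Rho_k by metis
  then have "ev (F 0) = ev (G 0)" by (auto simp: fps_eq_iff fps_X_mult_nth) (metis diff_Suc_1 nat.simps(3))
  then show ?thesis using True ev_inj by blast
next
  case False
  then have "ev (F i) = ev (G i)" using assms lf_Theta[of i] by (metis atLeastAtMost_iff less_one not_le)
  then show ?thesis by (rule ev_inj)
qed

text \<open>
  Each coefficient of a leaf field in the polar frame is a fixed multiple of one coefficient of the
  sequence, which reduces formal sums to real series.
\<close>

lemma lf_coeff:
  "\<exists>r i j. \<forall>F :: 'r::finite fld. \<forall>m. mcoeff (fps_nth (LF F q) d) m = r * cf F i j m"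
proof (cases q rule: coord_cases)
  case (1 l)
  show ?thesis
  proof (cases "odd d")
    case True
    then have "mcoeff (fps_nth (LF F q) d) m = c (\<sigma> l) / c (\<sigma> k) * cf F 0 (d div 2) m"
      for F :: "'r fld" and m
      using 1 by (auto simp: lf_Rho mult.assoc mcoeff_rconst_mult ev_nth cf_def sc_def elim!: oddE)
    then show ?thesis by blast
  next
    case False
    then have "mcoeff (fps_nth (LF F q) d) m = 0 * cf F 0 0 m"
      for F :: "'r fld" and m
      using 1 by (auto simp: lf_Rho mult.assoc mcoeff_rconst_mult ev_nth)
    then show ?thesis by blast
  qed
next
  case (2 l)
  then have "mcoeff (fps_nth (LF F q) d) m = (if even d then 1 else 0) * cf F l (d div 2) m"
    for F :: "'r fld" and m
    by (auto simp: lf_Theta ev_nth cf_def sc_def)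
  then show ?thesis by blast
next
  case 3
  then have "mcoeff (fps_nth (LF F q) d) m = 0 * cf F 0 0 m" for F :: "'r fld" and m
    by (simp add: lf_off_leaf)
  then show ?thesis by blast
qed

lemma formal_sums_lf:
  assumes "\<And>i j m. (\<lambda>l. cf (F l) i j m) sums cf G i j m"
  shows "formal_sums (\<lambda>l. LF (F l)) (LF G)"
  unfolding formal_sums_def
proof (intro allI)
  fix q d m
  obtain r i j where "\<forall>F :: 'a fld. \<forall>m. mcoeff (fps_nth (LF F q) d) m = r * cf F i j m"
    using lf_coeff by blast
  then show "(\<lambda>l. mcoeff (fps_nth (LF (F l) q) d) m) sums mcoeff (fps_nth (LF G q) d) m"
    using sums_mult[OF assms[of i j m], of r] by simp
qed

lemma lf_smul_rconst: "smul (rconst r) (LF F) = LF (tmul (fps_const (mconst r)) F)"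
  by (simp add: lf_tmul[symmetric] ev_const rconst_def)

lemma is_exp_ad_lf:
  assumes "fil s 1 S"
  shows "is_exp_ad n k \<sigma> (LF S) (LF x) (LF (expad s S x))"
proof -
  have "formal_sums (\<lambda>l. LF (tmul (fps_const (mconst (1 / fact l))) ((bk S ^^ l) x))) (LF (expad s S x))"
  proof (rule formal_sums_lf)
    fix i j m
    have "(\<lambda>l. cf ((bk S ^^ l) x) i j m / fact l) sums
        (\<Sum>l\<le>gdeg s i j m. cf ((bk S ^^ l) x) i j m / fact l)"
      using fil_bk_power[OF assms fil_0] by (intro sums_finite) (auto simp: fil_def)
    then show "(\<lambda>l. cf (tmul (fps_const (mconst (1 / fact l))) ((bk S ^^ l) x)) i j m)
        sums cf (expad s S x) i j m"
      unfolding expad_def cf_mk_fld by (simp add: tmul_def cf_def)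
  qed
  then show ?thesis by (simp add: is_exp_ad_def lf_bk_power lf_smul_rconst)
qed

lemma formal_sums_gr: "formal_sums (\<lambda>i. LF (gr s i W)) (LF W)"
proof (rule formal_sums_lf)
  fix i j m
  show "(\<lambda>g. cf (gr s g W) i j m) sums cf W i j m"
    unfolding cf_gr using sums_single[of "gdeg s i j m" "\<lambda>_. cf W i j m"] by (simp add: eq_commute)
qed

end


section \<open>The spectral sequence of a normalised field\<close>

text \<open>
  Up to grade \<open>s\<close> the generators of positive grade produce nothing, because the field has no part
  of grade below \<open>s\<close>; the complement is then the whole graded piece.
\<close>

definition nf_complement ::
  "nat \<Rightarrow> (nat \<Rightarrow> nat) \<Rightarrow> (nat \<Rightarrow> real) \<Rightarrow> nat \<Rightarrow> nat \<Rightarrow> 'r::finite vfield set" where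
  "nf_complement k \<sigma> c s g = {lf k \<sigma> c F | F. homog s g F \<and>
     (s < g \<longrightarrow> (\<forall>i j m. removed s i j \<longrightarrow> cf F i j m = 0))}"

context leaf_frame
begin

lemma ddom_diagonal:
  "ddom n k \<sigma> c s V i i T S \<longleftrightarrow>
     (\<forall>g. 1 \<le> g \<and> g \<le> i \<longrightarrow> T g \<in> time_grade s g \<and> S g \<in> leaf_grade k \<sigma> c s g) \<and>
     (\<forall>h<i. dmap n k \<sigma> V h h T S = 0)"
proof (induct i)
  case (Suc i)
  have "g \<le> Suc i \<longleftrightarrow> g \<le> i \<or> g = Suc i" for g by auto
  then show ?case using Suc by (auto simp: less_Suc_eq)
qed simp

lemma dmap_lf:
  assumes "\<And>g. 1 \<le> g \<Longrightarrow> g \<le> i \<Longrightarrow> T' g = ev (T g) \<and> S' g = LF (S g)"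
  shows "dmap n k \<sigma> (\<lambda>g. LF (V g)) i i T' S' = LF (dm V i i T S)"
  unfolding dmap_def dm_def lf_sum
proof (rule sum.cong[OF refl])
  fix j assume "j \<in> {..<i}"
  then have "1 \<le> i - j" "i - j \<le> i" by auto
  then show "smul (T' (i - j)) (LF (V j)) + brk n k \<sigma> (S' (i - j)) (LF (V j))
      = LF (act (T (i - j)) (S (i - j)) (V j))"
    using assms by (simp add: lf_act)
qed

lemma dimage_diagonal:
  "u \<in> dimage n k \<sigma> c s (\<lambda>g. LF (V g)) i i \<longleftrightarrow>
     (\<exists>T S. (\<forall>g. 1 \<le> g \<and> g \<le> i \<longrightarrow> thomog s g (T g) \<and> homog s g (S g) \<and> (\<forall>p>k. S g p = 0)) \<and>
       (\<forall>h<i. LF (dm V h h T S) = 0) \<and> u = LF (dm V i i T S))"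
  (is "_ \<longleftrightarrow> ?R")
proof
  assume "u \<in> dimage n k \<sigma> c s (\<lambda>g. LF (V g)) i i"
  then obtain T' S' where u: "u = dmap n k \<sigma> (\<lambda>g. LF (V g)) i i T' S'"
    and dom: "\<And>g. 1 \<le> g \<Longrightarrow> g \<le> i \<Longrightarrow> T' g \<in> time_grade s g \<and> S' g \<in> leaf_grade k \<sigma> c s g"
    and ker: "\<And>h. h < i \<Longrightarrow> dmap n k \<sigma> (\<lambda>g. LF (V g)) h h T' S' = 0"
    unfolding dimage_def ddom_diagonal by blast
  have "\<forall>g. \<exists>T. 1 \<le> g \<and> g \<le> i \<longrightarrow> T' g = ev T \<and> thomog s g T"
    using dom unfolding time_grade_iff by blast
  then obtain T where T: "\<And>g. 1 \<le> g \<Longrightarrow> g \<le> i \<Longrightarrow> T' g = ev (T g) \<and> thomog s g (T g)"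
    by metis
  have "\<forall>g. \<exists>S. 1 \<le> g \<and> g \<le> i \<longrightarrow> S' g = LF S \<and> homog s g S \<and> (\<forall>p>k. S p = 0)"
    using dom unfolding leaf_grade_iff by blast
  then obtain S where S: "\<And>g. 1 \<le> g \<Longrightarrow> g \<le> i \<Longrightarrow>
      S' g = LF (S g) \<and> homog s g (S g) \<and> (\<forall>p>k. S g p = 0)"
    by metis
  have "dmap n k \<sigma> (\<lambda>g. LF (V g)) h h T' S' = LF (dm V h h T S)" if "h \<le> i" for h
    using T S that by (intro dmap_lf) auto
  then show ?R
    using T S ker u by (intro exI[of _ T] exI[of _ S]) auto
next
  assume ?R
  then obtain T S where TS: "\<And>g. 1 \<le> g \<Longrightarrow> g \<le> i \<Longrightarrow> thomog s g (T g) \<and> homog s g (S g)"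
    and ker: "\<And>h. h < i \<Longrightarrow> LF (dm V h h T S) = 0" and u: "u = LF (dm V i i T S)"
    by blast
  have dmap: "dmap n k \<sigma> (\<lambda>g. LF (V g)) h h (\<lambda>g. ev (T g)) (\<lambda>g. LF (S g)) = LF (dm V h h T S)" for h
    by (rule dmap_lf) simp
  have "ddom n k \<sigma> c s (\<lambda>g. LF (V g)) i i (\<lambda>g. ev (T g)) (\<lambda>g. LF (S g))"
    unfolding ddom_diagonal dmap using TS ker lf_in_leaf_grade time_grade_iff by blast
  then show "u \<in> dimage n k \<sigma> c s (\<lambda>g. LF (V g)) i i"
    unfolding dimage_def u dmap[symmetric] by blast
qed

lemma dm_off_range:
  assumes "\<And>g. 1 \<le> g \<Longrightarrow> g \<le> i \<Longrightarrow> S g p = 0" "\<And>j. V j p = 0"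
  shows "dm V i i T S p = 0"
proof -
  have "act (T (i - j)) (S (i - j)) (V j) p = 0" if "j < i" for j
    using assms(1)[of "i - j"] assms(2)[of j] that by (simp add: act_def tmul_def bk_def)
  then have "cf (dm V i i T S) p l m = 0" for l m
    unfolding dm_def cf_sum by (intro sum.neutral) (simp add: cf_def)
  then show ?thesis by (intro ser_eqI) (simp add: cf_def)
qed

text \<open>
  For \<open>i > s\<close> this combines \<open>dm_meets_complement_trivially\<close> with \<open>dm_complement_spans\<close>.
\<close>

lemma is_complement_nf:
  fixes W :: "'r::finite fld"
  assumes nz: "\<alpha> \<noteq> 0" "e 1 \<noteq> 0" and W: "fil s (1 + s) (W - lead s \<alpha> e)"
    and trim: "\<And>i. k < i \<Longrightarrow> W i = 0" and i: "1 \<le> i"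
  shows "is_complement (leaf_grade k \<sigma> c s i)
    (dimage n k \<sigma> c s (\<lambda>g. LF (gr s g W)) i i) (nf_complement k \<sigma> c s i)"
proof -
  define V where "V h = gr s h W" for h
  have V0: "V h p = 0" if "k < p" for h p
    using trim[OF that] by (intro ser_eqI) (simp add: V_def gr_def mk_fld_def cf_def)
  have hom: "homog s i (dm V i i T S)"
    if "\<And>g. 1 \<le> g \<Longrightarrow> g \<le> i \<Longrightarrow> thomog s g (T g) \<and> homog s g (S g)" for T S
    by (rule homog_dm[OF that]) (simp_all add: V_def homog_gr)
  have zero: "0 \<in> nf_complement k \<sigma> c s i"
    unfolding nf_complement_def by (force intro: exI[of _ 0] simp: homog_def)
  have add: "u + v \<in> nf_complement k \<sigma> c s i"
    if uv: "u \<in> nf_complement k \<sigma> c s i" "v \<in> nf_complement k \<sigma> c s i" for u v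
  proof -
    obtain F G where "u = LF F" "v = LF G" "homog s i F" "homog s i G"
      "s < i \<longrightarrow> (\<forall>p j m. removed s p j \<longrightarrow> cf F p j m = 0)"
      "s < i \<longrightarrow> (\<forall>p j m. removed s p j \<longrightarrow> cf G p j m = 0)"
      using uv unfolding nf_complement_def by blast
    then show ?thesis
      unfolding nf_complement_def
      by (intro CollectI exI[of _ "F + G"]) (auto simp: lf_add homog_add)
  qed
  have scale: "smul (rconst r) u \<in> nf_complement k \<sigma> c s i" if u: "u \<in> nf_complement k \<sigma> c s i" for r u
  proof -
    obtain F where "u = LF F" "homog s i F"
      "s < i \<longrightarrow> (\<forall>p j m. removed s p j \<longrightarrow> cf F p j m = 0)"
      using u unfolding nf_complement_def by blast
    then show ?thesis
      unfolding nf_complement_def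
      by (intro CollectI exI[of _ "tmul (fps_const (mconst r)) F"])
        (auto simp: lf_smul_rconst homog_def cf_def tmul_def)
  qed
  have low: "dm V h h T S = 0" if "h \<le> s" for h T S
    using that unfolding dm_def by (intro sum.neutral) (simp add: V_def gr_eq_lead(1)[OF W])
  have zero_im: "0 \<in> dimage n k \<sigma> c s (\<lambda>g. LF (V g)) i i"
  proof -
    have "dm V h h (\<lambda>g. 0) (\<lambda>g. 0) = 0" for h unfolding dm_def by (simp add: zero_fun_def[symmetric])
    then show ?thesis
      unfolding dimage_diagonal
      by (intro exI[of _ "\<lambda>g. 0"]) (simp add: thomog_def homog_def)
  qed
  have meet: "u = 0" if u: "u \<in> dimage n k \<sigma> c s (\<lambda>g. LF (V g)) i i" "u \<in> nf_complement k \<sigma> c s i" for u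
  proof -
    obtain T S where TS: "\<And>g. 1 \<le> g \<Longrightarrow> g \<le> i \<Longrightarrow> thomog s g (T g) \<and> homog s g (S g)"
      and S0: "\<And>g p. 1 \<le> g \<Longrightarrow> g \<le> i \<Longrightarrow> k < p \<Longrightarrow> S g p = 0"
      and ker: "\<And>h. h < i \<Longrightarrow> LF (dm V h h T S) = 0" and ud: "u = LF (dm V i i T S)"
      using u(1) unfolding dimage_diagonal by blast
    have off: "dm V h h T S p = 0" if "h \<le> i" "k < p" for h p
      using S0 V0 that by (intro dm_off_range) auto
    have ker': "dm V h h T S = 0" if "h < i" for h
    proof
      fix p
      show "dm V h h T S p = 0 p"
        using off[of h p] lf_inj[of "dm V h h T S" 0 p] ker[OF that] that by (cases "p \<le> k") auto
    qed
    show ?thesis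
    proof (cases "s < i")
      case True
      obtain F where F: "u = LF F" "\<And>p j m. removed s p j \<Longrightarrow> cf F p j m = 0"
        using u(2) True unfolding nf_complement_def by blast
      have rem: "cf (dm V i i T S) p j m = 0" if "removed s p j" for p j m
      proof (cases "p \<le> k")
        case True
        then have "dm V i i T S p = F p" using lf_inj[of "dm V i i T S" F p] F(1) ud by simp
        then show ?thesis using F(2)[OF that] by (simp add: cf_def)
      qed (simp add: cf_def off)
      have "dm V i i T S = 0"
        unfolding V_def
        by (rule dm_meets_complement_trivially[of \<alpha> e s W i T S, OF nz W TS
              ker'[unfolded V_def] True rem[unfolded V_def]])
      then show ?thesis using ud by simp
    qed (simp add: ud low)
  qed
  have sub: "w + u \<in> leaf_grade k \<sigma> c s i"
    if wu: "w \<in> dimage n k \<sigma> c s (\<lambda>g. LF (V g)) i i" "u \<in> nf_complement k \<sigma> c s i" for w u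
  proof -
    obtain T S where TS: "\<And>g. 1 \<le> g \<Longrightarrow> g \<le> i \<Longrightarrow> thomog s g (T g) \<and> homog s g (S g)"
      and w: "w = LF (dm V i i T S)"
      using wu(1) unfolding dimage_diagonal by blast
    obtain F where F: "u = LF F" "homog s i F" using wu(2) unfolding nf_complement_def by blast
    have "homog s i (dm V i i T S + F)"
      by (intro homog_add hom F(2) TS)
    then show ?thesis unfolding w F(1) lf_add[symmetric] by (rule lf_in_leaf_grade)
  qed
  have span: "\<exists>w u. x = w + u \<and> w \<in> dimage n k \<sigma> c s (\<lambda>g. LF (V g)) i i \<and> u \<in> nf_complement k \<sigma> c s i"
    if x: "x \<in> leaf_grade k \<sigma> c s i" for x
  proof -
    obtain F where F: "x = LF F" "homog s i F" using x unfolding leaf_grade_iff by blast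
    show ?thesis
    proof (cases "s < i")
      case True
      obtain T S where TS: "\<And>g. thomog s g (T g) \<and> homog s g (S g)"
        and ker: "\<And>h. h < i \<Longrightarrow> dm V h h T S = 0"
        and rem: "\<And>p j m. removed s p j \<Longrightarrow> cf (F - dm V i i T S) p j m = 0"
        using dm_complement_spans[of \<alpha> e s W, OF nz W F(2) True] unfolding V_def by blast
      define S' where "S' g = trim k (S g)" for g
      have S': "homog s g (S' g)" "\<forall>p>k. S' g p = 0" for g
        using TS[of g] by (auto simp: S'_def homog_def cf_trim, simp add: trim_def)
      have dmS: "dm V h h T S' = trim k (dm V h h T S)" for h
      proof
        fix p
        show "dm V h h T S' p = trim k (dm V h h T S) p"
        proof (cases "p \<le> k")
          case True
          have "act (T g) (S' g) (V j) p = act (T g) (S g) (V j) p" for g j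
            using True by (simp add: S'_def act_def tmul_def bk_def trim_def)
          then have "cf (dm V h h T S') p l m = cf (dm V h h T S) p l m" for l m
            unfolding dm_def cf_sum by (simp add: cf_def)
          then show ?thesis using True by (intro ser_eqI) (simp add: cf_def trim_def)
        next
          case False
          then show ?thesis using dm_off_range[of h S' p V T] S'(2) V0 by (simp add: trim_def)
        qed
      qed
      have "LF (dm V i i T S') \<in> dimage n k \<sigma> c s (\<lambda>g. LF (V g)) i i"
        unfolding dimage_diagonal using TS S' ker
        by (intro exI[of _ T] exI[of _ S']) (auto simp: dmS lf_trim)
      moreover have "homog s i (F - dm V i i T S)"
        by (intro homog_diff hom F(2) TS)
      then have "LF (F - dm V i i T S) \<in> nf_complement k \<sigma> c s i"
        unfolding nf_complement_def using rem by blast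
      moreover have "x = LF (dm V i i T S') + LF (F - dm V i i T S)"
        by (simp add: dmS lf_trim lf_diff F(1))
      ultimately show ?thesis by blast
    next
      case False
      then have "x \<in> nf_complement k \<sigma> c s i"
        using F unfolding nf_complement_def by blast
      then show ?thesis using zero_im by (intro exI[of _ 0] exI[of _ x]) simp
    qed
  qed
  show ?thesis
    unfolding is_complement_def V_def[symmetric]
    using zero add scale zero_im meet sub span by (intro conjI ballI allI) blast+
qed

text \<open>
  On the leaf \<open>\<rho> (\<sigma> l) = r \<rho> (\<sigma> k)\<close> with the same factor \<open>r\<close> that occurs in \<open>Ehat\<close>, so the radial part
  has only odd powers of \<open>\<rho> (\<sigma> k)\<close>, with one factor absorbed by the radial unit vector; the
  rotational part has only even powers.
\<close>

lemma has_cartesian_form_lf: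
  fixes F :: "'r::finite fld"
  assumes deg: "\<And>i j. s < j \<Longrightarrow> fps_nth (F i) j = 0"
  shows "has_cartesian_form n k \<sigma> c (LF F) (w_cart k \<sigma> s (fps_nth (F 0)) (\<lambda>i. fps_nth (F i)))"
  unfolding has_cartesian_form_def
proof (intro ballI allI)
  fix p m i assume p: "p \<in> leaf n k \<sigma> c" and "i \<in> {1..n}"
  then obtain l where l: "i = \<sigma> l" "l \<in> {1..n}"
    using permutes_image[OF perm] by blast
  let ?w = "w_cart k \<sigma> s (fps_nth (F 0)) (\<lambda>i. fps_nth (F i)) m p (\<sigma> l)"
  have "(\<lambda>d. cart_term k \<sigma> (LF F) m p (\<sigma> l) d) sums ?w"
  proof (cases "l \<le> k")
    case False
    then have "p (\<sigma> l) = (0, 0)" using p l(2) by (auto simp: leaf_def)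
    then have "cart_term k \<sigma> (LF F) m p (\<sigma> l) d = 0" for d
      by (simp add: cart_term_def zero_prod_def[symmetric])
    moreover have "?w = 0"
      unfolding w_cart_def using False
      by (intro sum.neutral ballI) (auto simp: d_x_def d_y_def zero_prod_def)
    ultimately show ?thesis by simp
  next
    case True
    then have lk: "l \<in> {1..k}" using l by simp
    define x y R where "x = fst (p (\<sigma> l))" and "y = snd (p (\<sigma> l))" and "R = rho p (\<sigma> k)"
    define r where "r = c (\<sigma> l) / c (\<sigma> k)"
    have rho: "rho p (\<sigma> l) = r * R" "0 < rho p (\<sigma> l)"
      using p lk unfolding leaf_def r_def R_def by blast+
    then have rR: "r \<noteq> 0" "R \<noteq> 0" by auto
    have R2: "R ^ (2 * j) = ((fst (p (\<sigma> k)))\<^sup>2 + (snd (p (\<sigma> k)))\<^sup>2) ^ j" for j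
      by (simp add: R_def rho_def power_mult)
    define f1 where "f1 d = (if odd d then (cf F 0 (d div 2) m * R ^ (2 * (d div 2))) *\<^sub>R (x, y) else 0)" for d
    define f2 where "f2 d = (if even d then (cf F l (d div 2) m * R ^ (2 * (d div 2))) *\<^sub>R (- y, x) else 0)" for d
    have eq: "cart_term k \<sigma> (LF F) m p (\<sigma> l) d = f1 d + f2 d" for d
    proof (cases "odd d")
      case True
      then obtain j where j: "d = 2 * j + 1" by (elim oddE)
      then show ?thesis
        using rR by (simp add: cart_term_def f1_def f2_def lf_Rho[OF lk] lf_Theta[OF lk] ev_nth
            mult.assoc mcoeff_rconst_mult rho(1) r_def[symmetric] x_def y_def R_def[symmetric]
            cf_def sc_def prod_eq_iff)
    next
      case False
      then obtain j where j: "d = 2 * j" by auto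
      then show ?thesis
        using rR by (simp add: cart_term_def f1_def f2_def lf_Rho[OF lk] lf_Theta[OF lk] ev_nth
            mult.assoc mcoeff_rconst_mult rho(1) r_def[symmetric] x_def y_def R_def[symmetric]
            cf_def sc_def)
    qed
    have z: "cf F i j m = 0" if "s < j" for i j using deg[OF that] by (simp add: cf_def sc_def)
    have "(\<lambda>j. f1 (2 * j + 1)) sums (\<Sum>j=0..s. f1 (2 * j + 1))"
      by (rule sums_finite) (auto simp: f1_def z zero_prod_def)
    then have 1: "f1 sums (\<Sum>j=0..s. f1 (2 * j + 1))"
      by (subst (asm) sums_mono_reindex) (auto simp: strict_mono_def f1_def elim!: oddE)
    have "(\<lambda>j. f2 (2 * j)) sums (\<Sum>j=0..s. f2 (2 * j))"
      by (rule sums_finite) (auto simp: f2_def z zero_prod_def)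
    then have 2: "f2 sums (\<Sum>j=0..s. f2 (2 * j))"
      by (subst (asm) sums_mono_reindex) (auto simp: strict_mono_def f2_def elim!: evenE)
    define G where "G i j = R ^ (2 * j) *\<^sub>R
        ((mcoeff (fps_nth (F 0) j) m * fst (p (\<sigma> i)) - mcoeff (fps_nth (F i) j) m * snd (p (\<sigma> i)))
            *\<^sub>R d_x (\<sigma> i) (\<sigma> l)
         + (mcoeff (fps_nth (F 0) j) m * snd (p (\<sigma> i)) + mcoeff (fps_nth (F i) j) m * fst (p (\<sigma> i)))
            *\<^sub>R d_y (\<sigma> i) (\<sigma> l))" for i j
    have "?w = (\<Sum>i=1..k. \<Sum>j=0..s. G i j)"
      unfolding w_cart_def G_def R2 ..
    also have "\<dots> = (\<Sum>i\<in>{l}. \<Sum>j=0..s. G i j)"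
    proof (rule sum.mono_neutral_right)
      have "G i j = 0" if "i \<noteq> l" for i j
        using that by (simp add: G_def d_x_def d_y_def prod_eq_iff)
      then show "\<forall>i\<in>{1..k} - {l}. (\<Sum>j=0..s. G i j) = 0" by simp
    qed (use lk in auto)
    also have "\<dots> = (\<Sum>j=0..s. f1 (2 * j + 1) + f2 (2 * j))"
    proof -
      have "G l j = f1 (2 * j + 1) + f2 (2 * j)" for j
        by (simp add: G_def f1_def f2_def d_x_def d_y_def prod_eq_iff x_def y_def cf_def sc_def
            algebra_simps)
      then show ?thesis by simp
    qed
    also have "\<dots> = (\<Sum>j=0..s. f1 (2 * j + 1)) + (\<Sum>j=0..s. f2 (2 * j))"
      by (rule sum.distrib)
    finally show ?thesis
      unfolding eq using sums_add[OF 1 2] by simp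
  qed
  then show "(\<lambda>d. cart_term k \<sigma> (LF F) m p i d) sums
      w_cart k \<sigma> s (fps_nth (F 0)) (\<lambda>i. fps_nth (F i)) m p i"
    using l by simp
qed

end


section \<open>The infinite-level parametric leaf-normal form\<close>

theorem theorem4p3:
  fixes n k :: nat and \<sigma> :: "nat \<Rightarrow> nat" and c \<omega> :: "nat \<Rightarrow> real"
  assumes "1 \<le> k" and "k \<le> n"
    and "\<sigma> \<in> shuffles_nk n k"
    and "c \<in> pos_sphere n k \<sigma>"
    and "\<forall>i\<in>{1..n}. \<omega> i \<noteq> 0"
    and "\<forall>i j. 1 \<le> i \<and> i < j \<and> j \<le> n \<longrightarrow> \<omega> i / \<omega> j \<notin> \<rat>"
  shows "\<exists>\<C> :: nat \<Rightarrow> nat \<Rightarrow> 'r::finite vfield set.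
    \<forall>(a :: nat \<Rightarrow> 'r mser) (b :: nat \<Rightarrow> nat \<Rightarrow> 'r mser).
      at_zero (a 0) = 0 \<and> (\<forall>i\<in>{1..k}. at_zero (b i 0) = 0) \<and> (\<exists>j. at_zero (a j) \<noteq> 0) \<longrightarrow>
      (\<exists>s. s = (LEAST j. at_zero (a j) \<noteq> 0) \<and>
        (\<exists>(S :: 'r vfield) (T :: 'r lfun) (w :: 'r vfield) ah bh.
          near_id_generator k \<sigma> c S \<and> time_rescaling T \<and>
          is_exp_ad n k \<sigma> S
            (let v = Theta_k k \<sigma> \<omega> + leaf_field k \<sigma> c a b in v + smul T v)
            (Theta_k k \<sigma> \<omega> + w) \<and>
          infinite_level_nf n k \<sigma> c s (\<C> s) (Theta_k k \<sigma> \<omega> + w) \<and>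
          w \<in> leaf_alg k \<sigma> c \<and>
          has_cartesian_form n k \<sigma> c w (w_cart k \<sigma> s ah bh) \<and>
          (\<forall>j<s. at_zero (ah j) = 0) \<and>
          (\<forall>i\<in>{1..k}. at_zero (bh i 0) = 0) \<and>
          (\<forall>j<s. bh 1 j = 0) \<and>
          at_zero (a s) \<noteq> 0 \<and> ah s = mconst (at_zero (a s))))"
proof (intro exI[of _ "\<lambda>s. nf_complement k \<sigma> c s"] allI impI, elim conjE)
  fix a :: "nat \<Rightarrow> 'r mser" and b :: "nat \<Rightarrow> nat \<Rightarrow> 'r mser"
  assume a0: "at_zero (a 0) = 0" and b0: "\<forall>i\<in>{1..k}. at_zero (b i 0) = 0"
    and ex: "\<exists>j. at_zero (a j) \<noteq> 0"
  interpret leaf_frame n k \<sigma> c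
    using assms(1-4) by unfold_locales (auto simp: shuffles_nk_def pos_sphere_def)
  define s where "s = (LEAST j. at_zero (a j) \<noteq> 0)"
  define \<alpha> where "\<alpha> = at_zero (a s)"
  define e where "e i = (if i \<in> {1..k} then \<omega> (\<sigma> i) else 0)" for i
  have \<alpha>: "\<alpha> \<noteq> 0" unfolding \<alpha>_def s_def by (rule LeastI_ex[OF ex])
  have low: "at_zero (a j) = 0" if "j < s" for j
    using not_less_Least[OF that[unfolded s_def]] by blast
  have e1: "e 1 \<noteq> 0"
    using sigma_in[of 1] assms(1,2,5) by (auto simp: e_def)
  define om where "om = (\<lambda>i. if i = 0 then 0 else fps_const (mconst (e i)) :: 'r mser fps)"
  define v where "v = om + trim k (\<lambda>i. if i = 0 then Abs_fps a else Abs_fps (b i))"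
  have Theta: "Theta_k k \<sigma> \<omega> = LF om"
    unfolding Theta_k_def lf_def leaf_field_def
    by (auto intro!: sum.cong ext simp: smul_def om_def e_def rconst_def ev_def[symmetric] ev_const
        zero_fun_def[symmetric])
  have cf_om: "cf om i j m = (if 0 < i \<and> j = 0 \<and> m = 0 then e i else 0)" for i j m
    by (simp add: om_def cf_def sc_const)
  have LFv: "Theta_k k \<sigma> \<omega> + leaf_field k \<sigma> c a b = LF v"
    by (simp add: v_def lf_add lf_trim Theta leaf_field_eq_lf)
  have "fil s (1 + s) (v - lead s \<alpha> e)"
    unfolding fil_def
  proof (intro allI impI)
    fix i j and m :: "'r \<Rightarrow> nat" assume gd: "gdeg s i j m < 1 + s"
    have m: "m = 0"
    proof (rule ccontr)
      assume "m \<noteq> 0"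
      then have "1 * (s + 1) \<le> mdeg m * (s + 1)"
        by (intro mult_right_mono) (auto simp: Suc_le_eq mdeg_eq_0_iff)
      then show False using gd by (simp add: gdeg_def wt_def)
    qed
    show "cf (v - lead s \<alpha> e) i j m = 0"
    proof (cases "i = 0")
      case True
      then have "j \<le> s" using gd by (simp add: gdeg_def wt_def)
      then show ?thesis
        using True m low[of j]
        by (cases "j = s") (auto simp: v_def cf_om cf_trim cf_lead, auto simp: cf_def sc_def at_zero_def \<alpha>_def)
    next
      case False
      then have "j = 0" using gd by (simp add: gdeg_def wt_def)
      then show ?thesis
        using False m b0
        by (auto simp: v_def cf_om cf_trim cf_lead, auto simp: cf_def sc_def at_zero_def)
    qed
  qed
  then obtain T S where T: "ord_ge s 1 T" and S: "fil s 1 S"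
    and Sconst: "\<And>i. 0 < i \<Longrightarrow> fps_nth (S i) 0 = 0"
    and lead: "fil s (1 + s) (expad s S (v + tmul T v) - lead s \<alpha> e)"
    and rem: "\<And>i j m. removed s i j \<Longrightarrow> s < gdeg s i j m \<Longrightarrow>
      cf (expad s S (v + tmul T v)) i j m = 0"
    by (rule normalising_transformation_exists[of \<alpha> e, OF \<alpha> e1]) blast
  define W where "W = trim k (expad s S (v + tmul T v))"
  define F where "F = W - om"
  have Wlead: "fil s (1 + s) (W - lead s \<alpha> e)"
    using lead by (auto simp: fil_def W_def cf_trim cf_lead e_def)
  have Wk: "W i = 0" if "k < i" for i using that by (simp add: W_def trim_def)
  have Wrem: "cf W i j m = 0" if "removed s i j" "s < gdeg s i j m" for i j m
    using rem[OF that] by (simp add: W_def cf_trim)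
  have Wlow: "cf W i j m = cf (lead s \<alpha> e) i j m" if "gdeg s i j m \<le> s" for i j m
    using Wlead that by (simp add: fil_def)
  have ThF: "Theta_k k \<sigma> \<omega> + LF F = LF W"
    by (simp add: Theta F_def lf_diff)
  have expW: "LF (expad s S (v + tmul T v)) = LF W"
    by (simp add: W_def lf_trim)
  have near: "near_id_generator k \<sigma> c (LF S)"
  proof -
    have "at_zero (fps_nth (S 0) 0) = 0"
      using S[unfolded fil_def, rule_format, of 0 0 0]
      by (simp add: gdeg_def wt_def cf_def sc_def at_zero_def)
    moreover have "at_zero (fps_nth (S i) 0) = 0" if "i \<in> {1..k}" for i
      using Sconst[of i] that by (simp add: at_zero_def)
    ultimately show ?thesis unfolding near_id_generator_def lf_def by blast
  qed
  have time: "time_rescaling (ev T)"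
    using T[unfolded ord_ge_def, rule_format, of 0 0] unfolding time_rescaling_def ev_def
    by (intro exI[of _ "fps_nth T"]) (simp add: wt_def sc_def at_zero_def)
  have exp: "is_exp_ad n k \<sigma> (LF S)
      (let v = Theta_k k \<sigma> \<omega> + leaf_field k \<sigma> c a b in v + smul (ev T) v)
      (Theta_k k \<sigma> \<omega> + LF F)"
    using is_exp_ad_lf[OF S, of "v + tmul T v"]
    by (simp add: LFv ThF expW Let_def lf_add lf_tmul)
  have nf: "infinite_level_nf n k \<sigma> c s (nf_complement k \<sigma> c s) (Theta_k k \<sigma> \<omega> + LF F)"
    unfolding infinite_level_nf_def ThF
  proof (intro exI[of _ "\<lambda>g. LF (gr s g W)"] conjI allI impI)
    fix i
    show "LF (gr s i W) \<in> leaf_grade k \<sigma> c s i" by (rule lf_in_leaf_grade[OF homog_gr])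
  next
    show "formal_sums (\<lambda>g. LF (gr s g W)) (LF W)" by (rule formal_sums_gr)
  next
    fix i :: nat assume "1 \<le> i"
    then show "is_complement (leaf_grade k \<sigma> c s i)
        (dimage n k \<sigma> c s (\<lambda>g. LF (gr s g W)) i i) (nf_complement k \<sigma> c s i)"
      by (intro is_complement_nf[of \<alpha> e, OF \<alpha> e1 Wlead] Wk)
    show "LF (gr s i W) \<in> nf_complement k \<sigma> c s i"
      unfolding nf_complement_def using Wrem homog_gr
      by (intro CollectI exI[of _ "gr s i W"]) (auto simp: cf_gr)
  qed
  have deg: "fps_nth (F i) j = 0" if "s < j" for i j
  proof (rule mser_eqI)
    fix m :: "'r \<Rightarrow> nat"
    have "removed s i j" "s < gdeg s i j m" using that by (auto simp: removed_def gdeg_def wt_def)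
    then have "cf F i j m = 0" using that Wrem by (simp add: F_def cf_om)
    then show "mcoeff (fps_nth (F i) j) m = mcoeff 0 m" by (simp add: cf_def sc_def)
  qed
  have ah: "at_zero (fps_nth (F 0) j) = 0" if "j < s" for j
  proof -
    have "cf F 0 j 0 = 0" using Wlow[of 0 j 0] that by (simp add: F_def cf_om cf_lead gdeg_def wt_def)
    then show ?thesis by (simp add: cf_def sc_def at_zero_def)
  qed
  have bh: "at_zero (fps_nth (F i) 0) = 0" if "i \<in> {1..k}" for i
  proof -
    have "cf F i 0 0 = 0"
      using Wlow[of i 0 0] that by (simp add: F_def cf_om cf_lead gdeg_def wt_def)
    then show ?thesis by (simp add: cf_def sc_def at_zero_def)
  qed
  have b1: "fps_nth (F 1) j = 0" if "j < s" for j
  proof (rule mser_eqI)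
    fix m :: "'r \<Rightarrow> nat"
    have "cf F 1 j m = 0"
    proof (cases "gdeg s 1 j m \<le> s")
      case True
      then show ?thesis using Wlow[OF True] by (auto simp: F_def cf_om cf_lead)
    next
      case False
      then have "\<not> (j = 0 \<and> m = 0)" by (auto simp: gdeg_def wt_def)
      then show ?thesis using Wrem[of 1 j m] that False by (auto simp: F_def cf_om removed_def)
    qed
    then show "mcoeff (fps_nth (F 1) j) m = mcoeff 0 m" by (simp add: cf_def sc_def)
  qed
  have as: "fps_nth (F 0) s = mconst \<alpha>"
  proof (rule mser_eqI)
    fix m :: "'r \<Rightarrow> nat"
    have "cf F 0 s m = (if m = 0 then \<alpha> else 0)"
    proof (cases "gdeg s 0 s m \<le> s")
      case True
      then show ?thesis using Wlow[OF True] by (simp add: F_def cf_om cf_lead)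
    next
      case False
      then have "m \<noteq> 0" by (auto simp: gdeg_def wt_def)
      then show ?thesis using Wrem[of 0 s m] False by (simp add: F_def cf_om removed_def)
    qed
    then show "mcoeff (fps_nth (F 0) s) m = mcoeff (mconst \<alpha>) m"
      by (simp add: cf_def sc_def mconst_def)
  qed
  have alg: "LF F \<in> leaf_alg k \<sigma> c" unfolding leaf_alg_def lf_def by blast
  show "\<exists>s. s = (LEAST j. at_zero (a j) \<noteq> 0) \<and>
        (\<exists>(S :: 'r vfield) (T :: 'r lfun) (w :: 'r vfield) ah bh.
          near_id_generator k \<sigma> c S \<and> time_rescaling T \<and>
          is_exp_ad n k \<sigma> S
            (let v = Theta_k k \<sigma> \<omega> + leaf_field k \<sigma> c a b in v + smul T v)
            (Theta_k k \<sigma> \<omega> + w) \<and>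
          infinite_level_nf n k \<sigma> c s (nf_complement k \<sigma> c s) (Theta_k k \<sigma> \<omega> + w) \<and>
          w \<in> leaf_alg k \<sigma> c \<and>
          has_cartesian_form n k \<sigma> c w (w_cart k \<sigma> s ah bh) \<and>
          (\<forall>j<s. at_zero (ah j) = 0) \<and>
          (\<forall>i\<in>{1..k}. at_zero (bh i 0) = 0) \<and>
          (\<forall>j<s. bh 1 j = 0) \<and>
          at_zero (a s) \<noteq> 0 \<and> ah s = mconst (at_zero (a s)))"
    using near time exp nf alg has_cartesian_form_lf[OF deg] ah bh b1 as \<alpha>
    unfolding \<alpha>_def
    by (intro exI[of _ s] conjI exI[of _ "LF S"] exI[of _ "ev T"] exI[of _ "LF F"]
        exI[of _ "fps_nth (F 0)"] exI[of _ "\<lambda>i. fps_nth (F i)"] s_def ballI allI impI) auto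
qed

end
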